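(* Let $R=\mathbb{Z}[t^{\pm1}]$. The (classes of the) maximal ideals of $R$ form a basis for a free commutative submonoid of the ideal class monoid $\mathcal{I}(R)$, isomorphic to $\mathbb{N}^\infty$.
   Context: For an integral domain $R$, the ideal class monoid $\mathcal{I}(R)$ is the quotient of the monoid of nonzero ideals of $R$ under multiplication by the relation $I\sim J$ iff there exist nonzero $x,y\in R$ with $(x)I=(y)J$. $\mathbb{N}$ is the monoid of nonnegative integers under addition, and $\mathbb{N}^\infty$ is the free commutative monoid on a countably infinite set (direct sum of countably infinitely many copies of $\mathbb{N}$). *)

theory Defs
  imports
    "HOL-Library.Poly_Mapping"
    "HOL-Algebra.Ideal_Product"
    "HOL-Algebra.Algebraic_Closure_Type"
begin

section \<open>The ideal class monoid of an integral domain\<close>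

definition nonzero_ideals :: "('a, 'b) ring_scheme \<Rightarrow> 'a set set" where
  "nonzero_ideals R = {I. ideal I R \<and> I \<noteq> {\<zero>\<^bsub>R\<^esub>}}"

definition ideal_class_rel :: "('a, 'b) ring_scheme \<Rightarrow> ('a set \<times> 'a set) set" where
  "ideal_class_rel R = {(I, J). I \<in> nonzero_ideals R \<and> J \<in> nonzero_ideals R \<and>
     (\<exists>x \<in> carrier R - {\<zero>\<^bsub>R\<^esub>}. \<exists>y \<in> carrier R - {\<zero>\<^bsub>R\<^esub>}.
        (PIdl\<^bsub>R\<^esub> x) \<cdot>\<^bsub>R\<^esub> I = (PIdl\<^bsub>R\<^esub> y) \<cdot>\<^bsub>R\<^esub> J)}"

definition ideal_class :: "('a, 'b) ring_scheme \<Rightarrow> 'a set \<Rightarrow> 'a set set" where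
  "ideal_class R I = ideal_class_rel R `` {I}"

text \<open>The union in the multiplication is over all representatives; for a domain all the classes
  occurring in it coincide (lemma \<open>ideal_class_mult\<close>).\<close>

definition ideal_class_monoid :: "('a, 'b) ring_scheme \<Rightarrow> 'a set set monoid" where
  "ideal_class_monoid R =
     \<lparr>carrier = nonzero_ideals R // ideal_class_rel R,
      monoid.mult = (\<lambda>A B. \<Union>I\<in>A. \<Union>J\<in>B. ideal_class R (I \<cdot>\<^bsub>R\<^esub> J)),
      one = ideal_class R (carrier R)\<rparr>"

context domain
begin

lemma nonzero_ideals_ideal: "I \<in> nonzero_ideals R \<Longrightarrow> ideal I R"
  by (simp add: nonzero_ideals_def)

lemma nonzero_ideals_elem:
  assumes "I \<in> nonzero_ideals R"
  obtains a where "a \<in> I" "a \<in> carrier R" "a \<noteq> \<zero>"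
proof -
  have I: "ideal I R" "I \<noteq> {\<zero>}" using assms by (auto simp: nonzero_ideals_def)
  have "\<zero> \<in> I" using I(1) by (simp add: additive_subgroup.zero_closed ideal.axioms(1))
  then obtain a where "a \<in> I" "a \<noteq> \<zero>" using I(2) by blast
  moreover have "a \<in> carrier R" using I(1) \<open>a \<in> I\<close> by (meson ideal.Icarr)
  ultimately show ?thesis using that by blast
qed

lemma nonzero_ideals_prod:
  assumes "I \<in> nonzero_ideals R" "J \<in> nonzero_ideals R"
  shows "I \<cdot> J \<in> nonzero_ideals R"
proof -
  obtain a where a: "a \<in> I" "a \<in> carrier R" "a \<noteq> \<zero>" using assms(1) by (rule nonzero_ideals_elem)
  obtain b where b: "b \<in> J" "b \<in> carrier R" "b \<noteq> \<zero>" using assms(2) by (rule nonzero_ideals_elem)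
  have "a \<otimes> b \<in> I \<cdot> J" using a b by (intro ideal_prod.prod)
  moreover have "a \<otimes> b \<noteq> \<zero>" using a b integral_iff by blast
  ultimately have "I \<cdot> J \<noteq> {\<zero>}" by blast
  moreover have "ideal (I \<cdot> J) R" using assms by (intro ideal_prod_is_ideal nonzero_ideals_ideal)
  ultimately show ?thesis by (simp add: nonzero_ideals_def)
qed

lemma nonzero_ideals_PIdl:
  assumes "x \<in> carrier R - {\<zero>}"
  shows "PIdl x \<in> nonzero_ideals R"
proof -
  have "x \<in> PIdl x" "ideal (PIdl x) R" using assms by (auto intro: cgenideal_self cgenideal_ideal)
  then show ?thesis using assms by (auto simp: nonzero_ideals_def)
qed

lemma nonzero_ideals_carrier: "carrier R \<in> nonzero_ideals R"
proof -
  have "carrier R \<noteq> {\<zero>}" using one_closed zero_not_one by (metis singletonD)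
  then show ?thesis by (simp add: nonzero_ideals_def oneideal)
qed

lemma PIdl_prod:
  assumes "x \<in> carrier R" "y \<in> carrier R"
  shows "(PIdl x) \<cdot> (PIdl y) = PIdl (x \<otimes> y)"
proof
  have idl: "ideal (PIdl (x \<otimes> y)) R" using assms by (intro cgenideal_ideal) simp
  show "(PIdl x) \<cdot> (PIdl y) \<subseteq> PIdl (x \<otimes> y)"
  proof
    fix s assume "s \<in> (PIdl x) \<cdot> (PIdl y)"
    then show "s \<in> PIdl (x \<otimes> y)"
    proof (induct s rule: ideal_prod.induct)
      case (prod i j)
      then obtain u v where uv: "u \<in> carrier R" "v \<in> carrier R" "i = u \<otimes> x" "j = v \<otimes> y"
        unfolding cgenideal_def by auto
      then have "i \<otimes> j = (u \<otimes> v) \<otimes> (x \<otimes> y)" using assms by (simp add: m_ac)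
      then show ?case unfolding cgenideal_def using uv by blast
    next
      case (sum s1 s2)
      then show ?case using idl by (simp add: additive_subgroup.a_closed ideal.axioms(1))
    qed
  qed
  have "ideal ((PIdl x) \<cdot> (PIdl y)) R" using assms by (intro ideal_prod_is_ideal cgenideal_ideal)
  moreover have "x \<otimes> y \<in> (PIdl x) \<cdot> (PIdl y)"
    using assms by (intro ideal_prod.prod cgenideal_self)
  ultimately show "PIdl (x \<otimes> y) \<subseteq> (PIdl x) \<cdot> (PIdl y)" by (rule cgenideal_minimal)
qed

lemma ideal_prod_left_commute:
  assumes "ideal I R" "ideal J R" "ideal K R"
  shows "I \<cdot> (J \<cdot> K) = J \<cdot> (I \<cdot> K)"
proof -
  have "I \<cdot> (J \<cdot> K) = (I \<cdot> J) \<cdot> K" using assms by (simp only: ideal_prod_assoc)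
  also have "\<dots> = (J \<cdot> I) \<cdot> K" using assms by (simp only: ideal_prod_commute[of I J])
  also have "\<dots> = J \<cdot> (I \<cdot> K)" using assms by (simp only: ideal_prod_assoc)
  finally show ?thesis .
qed

lemma ideal_class_rel_cong:
  assumes "(I, I') \<in> ideal_class_rel R" "(J, J') \<in> ideal_class_rel R"
  shows "(I \<cdot> J, I' \<cdot> J') \<in> ideal_class_rel R"
proof -
  obtain x y where xy: "x \<in> carrier R - {\<zero>}" "y \<in> carrier R - {\<zero>}" "(PIdl x) \<cdot> I = (PIdl y) \<cdot> I'"
    and I: "I \<in> nonzero_ideals R" "I' \<in> nonzero_ideals R"
    using assms(1) unfolding ideal_class_rel_def by blast
  obtain u v where uv: "u \<in> carrier R - {\<zero>}" "v \<in> carrier R - {\<zero>}" "(PIdl u) \<cdot> J = (PIdl v) \<cdot> J'"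
    and J: "J \<in> nonzero_ideals R" "J' \<in> nonzero_ideals R"
    using assms(2) unfolding ideal_class_rel_def by blast
  have key: "(PIdl (a \<otimes> b)) \<cdot> (K \<cdot> L) = ((PIdl a) \<cdot> K) \<cdot> ((PIdl b) \<cdot> L)"
    if "a \<in> carrier R" "b \<in> carrier R" "ideal K R" "ideal L R" for a b K L
  proof -
    have "ideal (PIdl a) R" "ideal (PIdl b) R" using that by (auto intro: cgenideal_ideal)
    then show ?thesis using that
      by (simp add: PIdl_prod[symmetric] ideal_prod_assoc ideal_prod_is_ideal
          ideal_prod_left_commute[of "PIdl b" K])
  qed
  have "x \<otimes> u \<in> carrier R - {\<zero>}" "y \<otimes> v \<in> carrier R - {\<zero>}" using xy uv integral_iff by auto
  moreover have "(PIdl (x \<otimes> u)) \<cdot> (I \<cdot> J) = (PIdl (y \<otimes> v)) \<cdot> (I' \<cdot> J')"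
    using xy uv I J by (simp add: key nonzero_ideals_ideal)
  ultimately show ?thesis unfolding ideal_class_rel_def using I J nonzero_ideals_prod by blast
qed

lemma equiv_ideal_class_rel: "equiv (nonzero_ideals R) (ideal_class_rel R)"
proof (rule equivI)
  show "ideal_class_rel R \<subseteq> nonzero_ideals R \<times> nonzero_ideals R"
    by (auto simp: ideal_class_rel_def)
  show "refl_on (nonzero_ideals R) (ideal_class_rel R)"
  proof (rule refl_onI)
    fix I assume "I \<in> nonzero_ideals R"
    moreover have "\<one> \<in> carrier R - {\<zero>}" by simp
    ultimately show "(I, I) \<in> ideal_class_rel R" unfolding ideal_class_rel_def by blast
  qed
  show "sym (ideal_class_rel R)"
  proof (rule symI)
    fix I J assume "(I, J) \<in> ideal_class_rel R"
    then obtain x y where "x \<in> carrier R - {\<zero>}" "y \<in> carrier R - {\<zero>}"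
        "(PIdl y) \<cdot> J = (PIdl x) \<cdot> I" "I \<in> nonzero_ideals R" "J \<in> nonzero_ideals R"
      unfolding ideal_class_rel_def by force
    then show "(J, I) \<in> ideal_class_rel R" unfolding ideal_class_rel_def by blast
  qed
  show "trans (ideal_class_rel R)"
  proof (rule transI)
    fix I J K assume "(I, J) \<in> ideal_class_rel R" "(J, K) \<in> ideal_class_rel R"
    then obtain x y u v where *: "x \<in> carrier R - {\<zero>}" "y \<in> carrier R - {\<zero>}"
        "u \<in> carrier R - {\<zero>}" "v \<in> carrier R - {\<zero>}"
        "(PIdl x) \<cdot> I = (PIdl y) \<cdot> J" "(PIdl u) \<cdot> J = (PIdl v) \<cdot> K"
      and n: "I \<in> nonzero_ideals R" "J \<in> nonzero_ideals R" "K \<in> nonzero_ideals R"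
      unfolding ideal_class_rel_def by blast
    have idl: "ideal (PIdl x) R" "ideal (PIdl y) R" "ideal (PIdl u) R" "ideal (PIdl v) R"
      "ideal I R" "ideal J R" "ideal K R"
      using * n by (auto intro: cgenideal_ideal nonzero_ideals_ideal)
    have "(PIdl (u \<otimes> x)) \<cdot> I = (PIdl u) \<cdot> ((PIdl y) \<cdot> J)"
      using * idl by (simp add: PIdl_prod[symmetric] ideal_prod_assoc)
    also have "\<dots> = (PIdl y) \<cdot> ((PIdl v) \<cdot> K)"
      using * idl by (simp add: ideal_prod_left_commute[of "PIdl u"])
    also have "\<dots> = (PIdl (y \<otimes> v)) \<cdot> K"
      using * idl by (simp add: PIdl_prod[symmetric] ideal_prod_assoc)
    finally have "(PIdl (u \<otimes> x)) \<cdot> I = (PIdl (y \<otimes> v)) \<cdot> K" .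
    moreover have "u \<otimes> x \<in> carrier R - {\<zero>}" "y \<otimes> v \<in> carrier R - {\<zero>}"
      using * integral_iff by auto
    ultimately show "(I, K) \<in> ideal_class_rel R" unfolding ideal_class_rel_def using n by blast
  qed
qed

lemma ideal_class_mult:
  assumes "I \<in> nonzero_ideals R" "J \<in> nonzero_ideals R"
  shows "ideal_class R I \<otimes>\<^bsub>ideal_class_monoid R\<^esub> ideal_class R J = ideal_class R (I \<cdot> J)"
proof -
  have "(\<lambda>K L. ideal_class R (K \<cdot> L)) respects2 ideal_class_rel R"
    unfolding ideal_class_def
    by (intro congruent2I' equiv_class_eq[OF equiv_ideal_class_rel] ideal_class_rel_cong)
  from UN_equiv_class2[OF equiv_ideal_class_rel equiv_ideal_class_rel this assms]
  show ?thesis by (simp add: ideal_class_monoid_def ideal_class_def)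
qed

lemma carrier_ideal_class_monoid:
  "carrier (ideal_class_monoid R) = ideal_class R ` nonzero_ideals R"
  by (auto simp: ideal_class_monoid_def ideal_class_def quotient_def)

lemma comm_monoid_ideal_class_monoid: "comm_monoid (ideal_class_monoid R)"
proof (rule comm_monoidI)
  have one: "\<one>\<^bsub>ideal_class_monoid R\<^esub> = ideal_class R (carrier R)"
    by (simp add: ideal_class_monoid_def)
  show "\<one>\<^bsub>ideal_class_monoid R\<^esub> \<in> carrier (ideal_class_monoid R)"
    unfolding one carrier_ideal_class_monoid using nonzero_ideals_carrier by blast
  fix A assume "A \<in> carrier (ideal_class_monoid R)"
  then obtain I where A: "A = ideal_class R I" and I: "I \<in> nonzero_ideals R"
    unfolding carrier_ideal_class_monoid by blast
  show "\<one>\<^bsub>ideal_class_monoid R\<^esub> \<otimes>\<^bsub>ideal_class_monoid R\<^esub> A = A"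
    unfolding one A using I nonzero_ideals_carrier
    by (simp add: ideal_class_mult)
      (metis ideal_prod_commute ideal_prod_one nonzero_ideals_ideal oneideal)
  fix B assume "B \<in> carrier (ideal_class_monoid R)"
  then obtain J where B: "B = ideal_class R J" and J: "J \<in> nonzero_ideals R"
    unfolding carrier_ideal_class_monoid by blast
  show "A \<otimes>\<^bsub>ideal_class_monoid R\<^esub> B \<in> carrier (ideal_class_monoid R)"
    unfolding A B carrier_ideal_class_monoid using I J
    by (simp add: ideal_class_mult nonzero_ideals_prod)
  show "A \<otimes>\<^bsub>ideal_class_monoid R\<^esub> B = B \<otimes>\<^bsub>ideal_class_monoid R\<^esub> A"
    unfolding A B using I J
    by (simp add: ideal_class_mult ideal_prod_commute nonzero_ideals_ideal)
  fix C assume "C \<in> carrier (ideal_class_monoid R)"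
  then obtain K where C: "C = ideal_class R K" and K: "K \<in> nonzero_ideals R"
    unfolding carrier_ideal_class_monoid by blast
  show "A \<otimes>\<^bsub>ideal_class_monoid R\<^esub> B \<otimes>\<^bsub>ideal_class_monoid R\<^esub> C =
        A \<otimes>\<^bsub>ideal_class_monoid R\<^esub> (B \<otimes>\<^bsub>ideal_class_monoid R\<^esub> C)"
    unfolding A B C using I J K
    by (simp add: ideal_class_mult nonzero_ideals_prod ideal_prod_assoc nonzero_ideals_ideal)
qed

end


section \<open>Free commutative monoids and bases\<close>

text \<open>The free commutative monoid on \<open>B\<close> is the direct sum of copies of \<open>\<nat>\<close> indexed by \<open>B\<close>,
  i.e. the finitely supported functions to \<open>\<nat>\<close> with support in \<open>B\<close> under pointwise addition.\<close>

definition free_comm_monoid :: "'a set \<Rightarrow> ('a \<Rightarrow>\<^sub>0 nat) monoid" where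
  "free_comm_monoid B = \<lparr>carrier = {f. Poly_Mapping.keys f \<subseteq> B}, monoid.mult = (+), one = 0\<rparr>"

lemma comm_monoid_free_comm_monoid: "comm_monoid (free_comm_monoid B)"
proof (rule comm_monoidI)
  fix f g assume "f \<in> carrier (free_comm_monoid B)" "g \<in> carrier (free_comm_monoid B)"
  then show "f \<otimes>\<^bsub>free_comm_monoid B\<^esub> g \<in> carrier (free_comm_monoid B)"
    using Poly_Mapping.keys_add[of f g] by (simp add: free_comm_monoid_def) blast
qed (simp_all add: free_comm_monoid_def ac_simps)

definition nat_infinity :: "(nat \<Rightarrow>\<^sub>0 nat) monoid" where
  "nat_infinity = free_comm_monoid UNIV"

text \<open>\<open>B\<close> is a basis of the submonoid \<open>N\<close> of \<open>M\<close> if the canonical homomorphism from the free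
  commutative monoid on \<open>B\<close>, extending the inclusion of \<open>B\<close>, is an isomorphism onto \<open>N\<close>.\<close>

definition free_submonoid_basis :: "('a, 'b) monoid_scheme \<Rightarrow> 'a set \<Rightarrow> 'a set \<Rightarrow> bool" where
  "free_submonoid_basis M N B \<longleftrightarrow>
     comm_monoid M \<and> submonoid N M \<and> B \<subseteq> N \<and>
     (\<lambda>f. \<Otimes>\<^bsub>M\<^esub>b\<in>Poly_Mapping.keys f. b [^]\<^bsub>M\<^esub> Poly_Mapping.lookup f b)
       \<in> iso (free_comm_monoid B) (M\<lparr>carrier := N\<rparr>)"


section \<open>The ring of integral Laurent polynomials\<close>

text \<open>The multiplication of the type \<open>int \<Rightarrow>\<^sub>0 int\<close> is convolution, so this is the group ring of the
  infinite cyclic group: \<open>f\<close> stands for the sum of the \<open>lookup f k \<cdot> t\<^sup>k\<close>.\<close>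

definition int_laurent_ring :: "(int \<Rightarrow>\<^sub>0 int) ring" where
  "int_laurent_ring = ring_of_type_algebra"

lemma laurent_variable_unit: "Poly_Mapping.single 1 1 * Poly_Mapping.single (- 1) 1 = (1 :: int \<Rightarrow>\<^sub>0 int)"
  by (simp add: Poly_Mapping.mult_single)

lemma domain_int_laurent_ring: "domain int_laurent_ring"
proof -
  interpret cring int_laurent_ring
    unfolding int_laurent_ring_def by (rule cring_from_type_algebra)
  show ?thesis
    by unfold_locales (auto simp: int_laurent_ring_def ring_of_type_algebra_def)
qed

end

theory Submission
  imports Defs "HOL-Library.Countable_Set" "HOL-Computational_Algebra.Primes"
begin

text \<open>
  Let \<open>R = \<int>[t\<^sup>\<plusminus>\<^sup>1]\<close>. The proof isolates one property of the maximal ideals of \<open>R\<close>: each has the form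
  \<open>\<mm> = (p) + (s)\<close> with \<open>p\<close> a nonzero prime element and \<open>s \<notin> (p)\<close> (\<open>prime_pair\<close>). In any
  domain whose maximal ideals all have this form, their classes are distinct and form a basis of a
  free commutative submonoid (\<open>maximal_ideal_classes_basis\<close>), for two reasons.

  First, if all of \<open>x \<mm>\<close> is divisible by \<open>y\<close>, then so is \<open>x\<close>: since \<open>p\<close> and \<open>s\<close> are coprime,
  divisibility of \<open>x p\<close> and \<open>x s\<close> by \<open>y\<close> suffices. This property passes to products of ideals, and
  two equivalent ideals that have it are equal (\<open>ideal_class_rel_imp_eq\<close>). So on products of
  maximal ideals the passage to ideal classes loses nothing.

  Secondly, \<open>(R/(p))\<^sub>\<mm>\<close> is a discrete valuation ring with uniformizer \<open>s\<close>. The valuation of the image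
  of an ideal is additive on products, it is 1 for \<open>\<mm>\<close> and 0 for every other maximal ideal, so it
  reads off the exponent of \<open>\<mm>\<close> in a product of maximal ideals (\<open>has_order_prod\<close>,
  \<open>has_order_unique\<close>).

  For the Laurent polynomial ring the form of the maximal ideals is a version of the Nullstellensatz
  over \<open>\<int>\<close>. Everything comes from looking at the exponents of the monomials that survive modulo
  \<open>p\<close>, where \<open>p\<close> is a prime number or 0. As the largest and the smallest such exponent are additive,
  \<open>(p)\<close> is a prime ideal which is not maximal. Division with remainder modulo \<open>p\<close>, by an element
  \<open>f \<in> \<mm>\<close> with the least distance between its extreme exponents, shows that each element of \<open>\<mm>\<close> is
  multiplied into \<open>(p) + (f)\<close> by some power of the leading coefficient \<open>a\<close> of \<open>f\<close>. If \<open>p\<close> is a prime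
  number in \<open>\<mm>\<close>, then \<open>a\<close> is invertible modulo \<open>p\<close> and \<open>\<mm> = (p) + (f)\<close>. Suppose that \<open>\<mm>\<close> contained no
  prime number, hence no nonzero integer. With \<open>p = 0\<close> we choose a prime number \<open>q\<close> that does not
  divide the two extreme coefficients of \<open>f\<close>; since \<open>q\<close> is invertible modulo \<open>\<mm>\<close>, \<open>f\<close> divides a power
  of \<open>a\<close> modulo \<open>q\<close>. Hence \<open>f\<close> is a monomial modulo \<open>q\<close>, and so it is a monomial. But then its
  coefficient is a nonzero integer in \<open>\<mm>\<close>.

  Finally, there are only countably many pairs \<open>(p, s)\<close>, and the kernels of the maps
  \<open>R \<rightarrow> \<int>/q\<close>, \<open>t \<mapsto> 1\<close>, are infinitely many maximal ideals.
\<close>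


section \<open>Bases of free commutative submonoids\<close>

text \<open>
  The canonical homomorphism in the definition of \<open>free_submonoid_basis\<close>.
\<close>

definition power_prod :: "('a, 'b) monoid_scheme \<Rightarrow> ('a \<Rightarrow>\<^sub>0 nat) \<Rightarrow> 'a" where
  "power_prod M f = (\<Otimes>\<^bsub>M\<^esub>b\<in>Poly_Mapping.keys f. b [^]\<^bsub>M\<^esub> Poly_Mapping.lookup f b)"

text \<open>
  Over a common superset of the supports, products for different exponent functions can be
  multiplied factor by factor.
\<close>

lemma (in comm_monoid) power_prod_superset:
  assumes "finite A" "Poly_Mapping.keys f \<subseteq> A" "A \<subseteq> carrier G"
  shows "power_prod G f = (\<Otimes>b\<in>A. b [^] Poly_Mapping.lookup f b)"
  unfolding power_prod_def using assms
  by (intro finprod_mono_neutral_cong_left) (auto simp: in_keys_iff)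

lemma (in comm_monoid) power_prod_closed:
  assumes "Poly_Mapping.keys f \<subseteq> carrier G"
  shows "power_prod G f \<in> carrier G"
  unfolding power_prod_def using assms by (intro finprod_closed) auto

lemma (in comm_monoid) power_prod_zero: "power_prod G 0 = \<one>"
  by (simp add: power_prod_def)

lemma (in comm_monoid) power_prod_add:
  assumes "Poly_Mapping.keys f \<subseteq> carrier G" "Poly_Mapping.keys g \<subseteq> carrier G"
  shows "power_prod G (f + g) = power_prod G f \<otimes> power_prod G g"
proof -
  let ?A = "Poly_Mapping.keys f \<union> Poly_Mapping.keys g"
  have A: "finite ?A" "?A \<subseteq> carrier G" using assms by auto
  have "power_prod G (f + g) =
      (\<Otimes>b\<in>?A. b [^] Poly_Mapping.lookup f b \<otimes> b [^] Poly_Mapping.lookup g b)"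
    using A Poly_Mapping.keys_add[of f g]
    by (subst power_prod_superset[of ?A]) (auto simp: lookup_add nat_pow_mult intro!: finprod_cong')
  also have "\<dots> = power_prod G f \<otimes> power_prod G g"
    using A by (subst finprod_multf) (auto simp: power_prod_superset[of ?A])
  finally show ?thesis .
qed

text \<open>
  The image of the canonical homomorphism is the submonoid generated by \<open>B\<close>, so freeness is
  exactly injectivity.
\<close>

lemma (in comm_monoid) free_submonoid_basisI:
  assumes B: "B \<subseteq> carrier G"
    and inj: "inj_on (power_prod G) (carrier (free_comm_monoid B))"
  shows "free_submonoid_basis G (power_prod G ` carrier (free_comm_monoid B)) B"
proof -
  let ?F = "free_comm_monoid B"
  let ?N = "power_prod G ` carrier ?F"
  interpret F: comm_monoid ?F by (rule comm_monoid_free_comm_monoid)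
  have keys: "Poly_Mapping.keys f \<subseteq> carrier G" if "f \<in> carrier ?F" for f
    using that B by (auto simp: free_comm_monoid_def)
  have mult: "power_prod G (f \<otimes>\<^bsub>?F\<^esub> g) = power_prod G f \<otimes> power_prod G g"
    if "f \<in> carrier ?F" "g \<in> carrier ?F" for f g
    using that keys by (simp add: power_prod_add free_comm_monoid_def)
  have "submonoid ?N G"
  proof
    show "?N \<subseteq> carrier G" using keys power_prod_closed by blast
    have "0 \<in> carrier ?F" by (simp add: free_comm_monoid_def)
    then show "\<one> \<in> ?N" by (rule image_eqI[rotated]) (simp add: power_prod_zero)
    fix x y assume "x \<in> ?N" "y \<in> ?N"
    then obtain f g where "f \<in> carrier ?F" "g \<in> carrier ?F" "x = power_prod G f" "y = power_prod G g"
      by blast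
    then show "x \<otimes> y \<in> ?N" by (intro image_eqI[of _ _ "f \<otimes>\<^bsub>?F\<^esub> g"]) (simp_all add: mult)
  qed
  moreover have "B \<subseteq> ?N"
  proof
    fix b assume b: "b \<in> B"
    then have "power_prod G (Poly_Mapping.single b 1) = b"
      using B by (auto simp: power_prod_def)
    moreover have "Poly_Mapping.single b 1 \<in> carrier ?F" using b by (simp add: free_comm_monoid_def)
    ultimately show "b \<in> ?N" by (metis imageI)
  qed
  moreover have "power_prod G \<in> iso ?F (G\<lparr>carrier := ?N\<rparr>)"
    using mult inj by (auto simp: iso_def hom_def bij_betw_def)
  ultimately show ?thesis
    unfolding free_submonoid_basis_def
    using comm_monoid_axioms by (simp add: power_prod_def[abs_def])
qed

text \<open>
  The inverse of a bijective homomorphism is multiplicative because it may be applied to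
  \<open>h (h\<inverse> x \<otimes> h\<inverse> y) = x \<otimes> y\<close>.
\<close>

lemma (in monoid) iso_sym_monoid:
  assumes "h \<in> iso G H"
  shows "H \<cong> G"
proof -
  let ?k = "inv_into (carrier G) h"
  have h: "h \<in> hom G H" "bij_betw h (carrier G) (carrier H)" using assms by (auto simp: iso_def)
  have k: "bij_betw ?k (carrier H) (carrier G)" by (rule bij_betw_inv_into[OF h(2)])
  have "?k (x \<otimes>\<^bsub>H\<^esub> y) = ?k x \<otimes> ?k y" if "x \<in> carrier H" "y \<in> carrier H" for x y
  proof -
    have c: "?k x \<in> carrier G" "?k y \<in> carrier G" using k that bij_betwE by blast+
    then have "h (?k x \<otimes> ?k y) = x \<otimes>\<^bsub>H\<^esub> y"
      using h that by (simp add: hom_mult bij_betw_inv_into_right[OF h(2)])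
    then show ?thesis using c h(2) by (metis bij_betw_inv_into_left m_closed)
  qed
  then have "?k \<in> hom H G" using k by (auto simp: hom_def bij_betw_def)
  then show ?thesis using k by (auto simp: is_iso_def iso_def)
qed

lemma free_comm_monoid_reindex:
  assumes bij: "bij_betw h UNIV B"
  shows "Poly_Mapping.map_key h \<in> iso (free_comm_monoid B) (free_comm_monoid UNIV)"
proof -
  let ?k = "Poly_Mapping.map_key h :: ('b \<Rightarrow>\<^sub>0 nat) \<Rightarrow> ('a \<Rightarrow>\<^sub>0 nat)"
  have inj: "inj h" and B: "range h = B" using bij by (auto simp: bij_betw_def)
  have lookup: "Poly_Mapping.lookup (?k f) a = Poly_Mapping.lookup f (h a)" for f a
    using inj by (simp add: map_key.rep_eq)
  have "inj_on ?k (carrier (free_comm_monoid B))"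
  proof (rule inj_onI)
    fix f g assume fg: "f \<in> carrier (free_comm_monoid B)" "g \<in> carrier (free_comm_monoid B)"
      and eq: "?k f = ?k g"
    show "f = g"
    proof (rule poly_mapping_eqI)
      fix b
      show "Poly_Mapping.lookup f b = Poly_Mapping.lookup g b"
      proof (cases "b \<in> B")
        case True
        then show ?thesis using B lookup eq by (metis imageE)
      next
        case False
        then have "b \<notin> Poly_Mapping.keys f" "b \<notin> Poly_Mapping.keys g"
          using fg by (auto simp: free_comm_monoid_def)
        then show ?thesis by (simp add: in_keys_iff)
      qed
    qed
  qed
  moreover have "g \<in> ?k ` carrier (free_comm_monoid B)" for g
  proof
    define f where "f = (\<Sum>a\<in>Poly_Mapping.keys g. Poly_Mapping.single (h a) (Poly_Mapping.lookup g a))"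
    have "Poly_Mapping.lookup f (h a) = Poly_Mapping.lookup g a" for a
      by (simp add: f_def lookup_sum lookup_single when_def inj_eq[OF inj] in_keys_iff sum.delta)
    then show "g = ?k f" by (intro poly_mapping_eqI) (simp add: lookup)
    have "Poly_Mapping.keys f \<subseteq> B"
      unfolding f_def using keys_sum[of "\<lambda>a. Poly_Mapping.single (h a) (Poly_Mapping.lookup g a)"] B
      by fastforce
    then show "f \<in> carrier (free_comm_monoid B)" by (simp add: free_comm_monoid_def)
  qed
  ultimately show ?thesis
    by (auto simp: iso_def hom_def bij_betw_def free_comm_monoid_def map_key_plus[OF inj])
qed

lemma free_submonoid_iso_nat_infinity:
  assumes basis: "free_submonoid_basis M N B" and B: "countable B" "infinite B"
  shows "M\<lparr>carrier := N\<rparr> \<cong> nat_infinity"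
proof -
  interpret comm_monoid "free_comm_monoid B" by (rule comm_monoid_free_comm_monoid)
  have "power_prod M \<in> iso (free_comm_monoid B) (M\<lparr>carrier := N\<rparr>)"
    using basis unfolding free_submonoid_basis_def power_prod_def[abs_def] by (elim conjE)
  then have "M\<lparr>carrier := N\<rparr> \<cong> free_comm_monoid B" by (rule iso_sym_monoid)
  moreover have "free_comm_monoid B \<cong> nat_infinity"
    unfolding nat_infinity_def
    using free_comm_monoid_reindex[OF bij_betw_from_nat_into[OF B]] by (rule is_isoI)
  ultimately show ?thesis by (rule iso_trans)
qed


section \<open>Domains with maximal ideals generated by a prime element and one more element\<close>

context domain
begin

text \<open>
  These conditions make \<open>m/(p)\<close> a nonzero principal maximal ideal of the domain \<open>R/(p)\<close>, so that the
  localization \<open>(R/(p))\<^sub>m\<close> is a discrete valuation ring with uniformizer \<open>s\<close>, and they make \<open>p\<close> and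
  \<open>s\<close> coprime.
\<close>

definition prime_pair :: "'a set \<Rightarrow> 'a \<Rightarrow> 'a \<Rightarrow> bool" where
  "prime_pair m p s \<longleftrightarrow> maximalideal m R \<and> p \<in> carrier R \<and> s \<in> carrier R \<and> p \<noteq> \<zero> \<and>
     primeideal (PIdl p) R \<and> s \<notin> PIdl p \<and> m = PIdl p <+>\<^bsub>R\<^esub> PIdl s"

lemma prime_pairD:
  assumes "prime_pair m p s"
  shows "maximalideal m R" "ideal m R" "primeideal m R" "p \<in> carrier R" "s \<in> carrier R" "p \<noteq> \<zero>"
    "primeideal (PIdl p) R" "s \<notin> PIdl p" "m = PIdl p <+>\<^bsub>R\<^esub> PIdl s"
  using assms maximalideal_prime maximalideal.axioms(1) by (auto simp: prime_pair_def)

lemma PIdl_sum_iff: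
  "x \<in> PIdl a <+>\<^bsub>R\<^esub> PIdl b \<longleftrightarrow> (\<exists>u\<in>carrier R. \<exists>v\<in>carrier R. x = u \<otimes> a \<oplus> v \<otimes> b)"
  unfolding set_add_def' cgenideal_def by blast

lemma PIdl_iff: "x \<in> PIdl a \<longleftrightarrow> (\<exists>u\<in>carrier R. x = u \<otimes> a)"
  unfolding cgenideal_def by blast

lemma prime_pair_mem:
  assumes "prime_pair m p s"
  shows "p \<in> m" "s \<in> m"
proof -
  note d = prime_pairD[OF assms]
  have "p = \<one> \<otimes> p \<oplus> \<zero> \<otimes> s" "s = \<zero> \<otimes> p \<oplus> \<one> \<otimes> s" using d by simp_all
  then show "p \<in> m" "s \<in> m" unfolding d(9) PIdl_sum_iff by (meson one_closed zero_closed)+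
qed

lemma prime_pair_nonzero: "prime_pair m p s \<Longrightarrow> m \<in> nonzero_ideals R"
  using prime_pairD(2,6) prime_pair_mem(1) unfolding nonzero_ideals_def by blast

text \<open>
  In terms of the field of fractions: a fraction \<open>x/y\<close> with \<open>(x/y) I \<subseteq> R\<close> lies in \<open>R\<close>, so that the
  divisorial closure of \<open>I\<close> is \<open>R\<close>.
\<close>

definition no_common_denominator :: "'a set \<Rightarrow> bool" where
  "no_common_denominator I \<longleftrightarrow> (\<forall>x\<in>carrier R. \<forall>y\<in>carrier R. (\<forall>a\<in>I. y divides x \<otimes> a) \<longrightarrow> y divides x)"

lemma no_common_denominatorD:
  "\<lbrakk>no_common_denominator I; x \<in> carrier R; y \<in> carrier R; \<And>a. a \<in> I \<Longrightarrow> y divides x \<otimes> a\<rbrakk>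
     \<Longrightarrow> y divides x"
  by (simp add: no_common_denominator_def)

lemma no_common_denominator_carrier: "no_common_denominator (carrier R)"
  unfolding no_common_denominator_def by (force dest: bspec[of _ _ \<one>])

text \<open>
  Cancel the elements of the two ideals one after the other: for fixed \<open>b \<in> J\<close>, the property of
  \<open>I\<close> applies to the numerator \<open>x b\<close>.
\<close>

lemma no_common_denominator_prod:
  assumes "ideal I R" "ideal J R" "no_common_denominator I" "no_common_denominator J"
  shows "no_common_denominator (I \<cdot> J)"
  unfolding no_common_denominator_def
proof (intro ballI impI)
  fix x y assume x: "x \<in> carrier R" and y: "y \<in> carrier R" and *: "\<forall>a\<in>I \<cdot> J. y divides x \<otimes> a"
  have "y divides x \<otimes> b" if b: "b \<in> J" for b
  proof (rule no_common_denominatorD[OF assms(3)])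
    show "x \<otimes> b \<in> carrier R" using x b assms(2) by (meson ideal.Icarr m_closed)
    fix a assume a: "a \<in> I"
    have ab: "a \<in> carrier R" "b \<in> carrier R" using a b assms by (meson ideal.Icarr)+
    have "y divides x \<otimes> (a \<otimes> b)" using * a b by (blast intro: ideal_prod.prod)
    then show "y divides x \<otimes> b \<otimes> a" using x ab by (simp add: m_ac)
  qed (rule y)
  then show "y divides x" by (rule no_common_denominatorD[OF assms(4) x y])
qed

text \<open>
  From \<open>x p = y u\<close> and \<open>x s = y v\<close> follows \<open>u s = v p\<close>. As \<open>p\<close> is prime and does not divide \<open>s\<close>, it
  divides \<open>u\<close>, and cancelling \<open>p\<close> in \<open>x p = y u\<close> shows that \<open>y\<close> divides \<open>x\<close>.
\<close>

lemma no_common_denominator_prime_pair: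
  assumes "prime_pair m p s"
  shows "no_common_denominator m"
  unfolding no_common_denominator_def
proof (intro ballI impI)
  note d = prime_pairD[OF assms]
  interpret P: primeideal "PIdl p" R by (rule d)
  fix x y assume x: "x \<in> carrier R" and y: "y \<in> carrier R" and *: "\<forall>a\<in>m. y divides x \<otimes> a"
  have "y divides x \<otimes> p" "y divides x \<otimes> s" using * prime_pair_mem[OF assms] by auto
  then obtain u v where uv: "u \<in> carrier R" "v \<in> carrier R" "x \<otimes> p = y \<otimes> u" "x \<otimes> s = y \<otimes> v"
    by (auto simp: factor_def)
  show "y divides x"
  proof (cases "y = \<zero>")
    case True
    then have "x \<otimes> p = \<zero>" using uv by simp
    then have "x = \<zero>" using x d by (simp add: integral_iff)
    then show ?thesis using y by (auto simp: factor_def intro!: bexI[of _ \<zero>])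
  next
    case False
    have "y \<otimes> (u \<otimes> s) = (y \<otimes> u) \<otimes> s" using y uv(1,2) d by (simp add: m_assoc)
    also have "\<dots> = (x \<otimes> s) \<otimes> p" unfolding uv(3)[symmetric] using x d by (simp add: m_ac)
    also have "\<dots> = y \<otimes> (v \<otimes> p)" unfolding uv(4) using y uv(1,2) d by (simp add: m_assoc)
    finally have "u \<otimes> s = v \<otimes> p" using False y uv(1,2) d by (simp add: m_lcancel)
    then have "u \<otimes> s \<in> PIdl p" using uv by (auto simp: PIdl_iff)
    then have "u \<in> PIdl p" using P.I_prime uv d by blast
    then obtain w where w: "w \<in> carrier R" "u = w \<otimes> p" by (auto simp: PIdl_iff)
    have "x \<otimes> p = (y \<otimes> w) \<otimes> p" using uv w y d by (simp add: m_ac)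
    then have "x = y \<otimes> w" using d x y w by (simp add: m_rcancel)
    then show ?thesis using w by (auto simp: factor_def)
  qed
qed

text \<open>
  If \<open>(x) I = (y) J\<close>, then \<open>y\<close> divides \<open>x I\<close> and \<open>x\<close> divides \<open>y J\<close>, so \<open>x\<close> and \<open>y\<close> divide each other and
  can be cancelled.
\<close>

lemma ideal_class_rel_imp_eq:
  assumes rel: "(I, J) \<in> ideal_class_rel R"
    and nd: "no_common_denominator I" "no_common_denominator J"
  shows "I = J"
proof -
  obtain x y where xy: "x \<in> carrier R" "x \<noteq> \<zero>" "y \<in> carrier R" "y \<noteq> \<zero>"
      "(PIdl x) \<cdot> I = (PIdl y) \<cdot> J"
    and I: "ideal I R" and J: "ideal J R"
    using rel by (auto simp: ideal_class_rel_def nonzero_ideals_def)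
  have mult: "\<exists>b\<in>B. w \<otimes> b = z \<otimes> a"
    if "ideal A R" "ideal B R" "(PIdl z) \<cdot> A = (PIdl w) \<cdot> B" "a \<in> A" "z \<in> carrier R" "w \<in> carrier R" for A B z w a
  proof -
    interpret B: ideal B R by fact
    have "z \<otimes> a \<in> (PIdl z) \<cdot> A" using that by (intro ideal_prod.prod cgenideal_self)
    then have "z \<otimes> a \<in> (PIdl w) \<cdot> B" using that by simp
    then show ?thesis
    proof (induct rule: ideal_prod.induct)
      case (prod i j)
      then obtain u where u: "u \<in> carrier R" "i = u \<otimes> w" by (auto simp: PIdl_iff)
      have "j \<in> carrier R" using prod by simp
      then show ?case using u prod that(6) B.I_l_closed[of j u]
        by (intro bexI[of _ "u \<otimes> j"]) (simp_all add: m_ac)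
    next
      case (sum s1 s2)
      then obtain b1 b2 where b: "b1 \<in> B" "b2 \<in> B" "s1 = w \<otimes> b1" "s2 = w \<otimes> b2" by metis
      then show ?case using that(6) by (intro bexI[of _ "b1 \<oplus> b2"]) (simp_all add: r_distr)
    qed
  qed
  have sym: "(PIdl y) \<cdot> J = (PIdl x) \<cdot> I" using xy by simp
  have "y divides x"
  proof (rule no_common_denominatorD[OF nd(1) xy(1,3)])
    fix a assume "a \<in> I"
    then obtain b where "b \<in> J" "y \<otimes> b = x \<otimes> a" using mult[OF I J xy(5)] xy by blast
    then show "y divides x \<otimes> a" using J by (metis dividesI ideal.Icarr)
  qed
  moreover have "x divides y"
  proof (rule no_common_denominatorD[OF nd(2) xy(3,1)])
    fix b assume "b \<in> J"
    then obtain a where "a \<in> I" "x \<otimes> a = y \<otimes> b" using mult[OF J I sym] xy by blast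
    then show "x divides y \<otimes> b" using I by (metis dividesI ideal.Icarr)
  qed
  ultimately obtain c d where cd: "c \<in> carrier R" "d \<in> carrier R" "x = y \<otimes> c" "y = x \<otimes> d"
    by (auto simp: factor_def)
  show "I = J"
  proof (intro equalityI subsetI)
    fix a assume a: "a \<in> I"
    then have ac: "a \<in> carrier R" using I by (meson ideal.Icarr)
    obtain b where b: "b \<in> J" "y \<otimes> b = x \<otimes> a" using mult[OF I J xy(5) a] xy by blast
    have bc: "b \<in> carrier R" using b J by (meson ideal.Icarr)
    have "x \<otimes> a = (x \<otimes> d) \<otimes> b" unfolding cd(4)[symmetric] by (rule b(2)[symmetric])
    then have "x \<otimes> a = x \<otimes> (d \<otimes> b)" using cd(2) bc xy(1) by (simp only: m_assoc)
    then have "a = d \<otimes> b" by (rule iffD1[OF m_lcancel[OF xy(2,1) ac m_closed[OF cd(2) bc]]])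
    then show "a \<in> J" using b(1) cd(2) J by (simp add: ideal.I_l_closed)
  next
    fix b assume b: "b \<in> J"
    then have bc: "b \<in> carrier R" using J by (meson ideal.Icarr)
    obtain a where a: "a \<in> I" "x \<otimes> a = y \<otimes> b" using mult[OF J I sym b] xy by blast
    have ac: "a \<in> carrier R" using a I by (meson ideal.Icarr)
    have "y \<otimes> b = (y \<otimes> c) \<otimes> a" unfolding cd(3)[symmetric] by (rule a(2)[symmetric])
    then have "y \<otimes> b = y \<otimes> (c \<otimes> a)" using cd(1) ac xy(3) by (simp only: m_assoc)
    then have "b = c \<otimes> a" by (rule iffD1[OF m_lcancel[OF xy(4,3) bc m_closed[OF cd(1) ac]]])
    then show "b \<in> I" using a(1) cd(1) I by (simp add: ideal.I_l_closed)
  qed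
qed

text \<open>
  The image of \<open>I\<close> in the discrete valuation ring \<open>(R/(p))\<^sub>m\<close> is the ideal generated by \<open>s\<^sup>k\<close>,
  expressed without quotients and localizations: the first conjunct bounds the valuation of all
  elements of \<open>I\<close> from below by \<open>k\<close>, the second provides an element of valuation \<open>k\<close>.
\<close>

definition has_order :: "'a set \<Rightarrow> 'a \<Rightarrow> 'a \<Rightarrow> 'a set \<Rightarrow> nat \<Rightarrow> bool" where
  "has_order m p s I k \<longleftrightarrow>
     I \<subseteq> PIdl p <+>\<^bsub>R\<^esub> PIdl (s [^] k) \<and> (\<exists>c\<in>carrier R - m. s [^] k \<otimes> c \<in> I)"

lemma has_order_prod:
  assumes mps: "prime_pair m p s" and I: "ideal I R" and J: "ideal J R"
    and "has_order m p s I j" "has_order m p s J k"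
  shows "has_order m p s (I \<cdot> J) (j + k)"
proof -
  note d = prime_pairD[OF mps]
  interpret M: primeideal m R by (rule d)
  let ?T = "PIdl p <+>\<^bsub>R\<^esub> PIdl (s [^] (j + k))"
  have T: "ideal ?T R" using d by (intro add_ideals cgenideal_ideal) auto
  have "I \<cdot> J \<subseteq> ?T"
  proof
    fix z assume "z \<in> I \<cdot> J"
    then show "z \<in> ?T"
    proof (induct rule: ideal_prod.induct)
      case (prod a b)
      then have "a \<in> PIdl p <+>\<^bsub>R\<^esub> PIdl (s [^] j)" "b \<in> PIdl p <+>\<^bsub>R\<^esub> PIdl (s [^] k)"
        using assms by (auto simp: has_order_def)
      then obtain u v u' v' where uv: "u \<in> carrier R" "v \<in> carrier R" "u' \<in> carrier R" "v' \<in> carrier R"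
          "a = u \<otimes> p \<oplus> v \<otimes> s [^] j" "b = u' \<otimes> p \<oplus> v' \<otimes> s [^] k"
        unfolding PIdl_sum_iff by blast
      define S T where "S = s [^] j" and "T = s [^] k"
      have ST: "S \<in> carrier R" "T \<in> carrier R" using d by (simp_all add: S_def T_def)
      have "a \<otimes> b = (u \<otimes> u' \<otimes> p \<oplus> u \<otimes> v' \<otimes> T \<oplus> v \<otimes> S \<otimes> u') \<otimes> p \<oplus> (v \<otimes> v') \<otimes> (S \<otimes> T)"
        unfolding uv(5,6) S_def[symmetric] T_def[symmetric]
        using uv(1-4) ST d(4) by algebra
      moreover have "S \<otimes> T = s [^] (j + k)" using d by (simp add: S_def T_def nat_pow_mult)
      ultimately show ?case
        using uv(1-4) ST d(4) unfolding PIdl_sum_iff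
        by (intro bexI[of _ "u \<otimes> u' \<otimes> p \<oplus> u \<otimes> v' \<otimes> T \<oplus> v \<otimes> S \<otimes> u'"] bexI[of _ "v \<otimes> v'"]) simp_all
    next
      case (sum s1 s2)
      then show ?case using T by (simp add: additive_subgroup.a_closed ideal.axioms(1))
    qed
  qed
  moreover obtain c where c: "c \<in> carrier R" "c \<notin> m" "s [^] j \<otimes> c \<in> I"
    using assms by (auto simp: has_order_def)
  moreover obtain e where e: "e \<in> carrier R" "e \<notin> m" "s [^] k \<otimes> e \<in> J"
    using assms by (auto simp: has_order_def)
  have "c \<otimes> e \<in> carrier R - m" using c e M.I_prime by blast
  moreover have "s [^] (j + k) \<otimes> (c \<otimes> e) = (s [^] j \<otimes> c) \<otimes> (s [^] k \<otimes> e)"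
  proof -
    have "s [^] (j + k) = s [^] j \<otimes> s [^] k" using d by (simp add: nat_pow_mult)
    then show ?thesis using d(5) c(1) e(1) by (simp add: m_ac)
  qed
  then have "s [^] (j + k) \<otimes> (c \<otimes> e) \<in> I \<cdot> J" using c e by (simp add: ideal_prod.prod)
  ultimately show ?thesis unfolding has_order_def by blast
qed

text \<open>
  If \<open>s\<^sup>j c \<in> (p) + (s\<^sup>k)\<close> with \<open>j < k\<close>, cancelling \<open>s\<^sup>j\<close> modulo the prime \<open>p\<close> gives \<open>c \<in> (p) + (s) = m\<close>,
  which contradicts the choice of \<open>c\<close>. This replaces the appeal to Nakayama's lemma in the usual
  proof that the powers of \<open>m\<close> are distinct.
\<close>

lemma has_order_unique:
  assumes mps: "prime_pair m p s" and "has_order m p s I j" "has_order m p s I k"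
  shows "j = k"
proof -
  note d = prime_pairD[OF mps]
  interpret M: maximalideal m R by (rule d)
  interpret P: primeideal "PIdl p" R by (rule d)
  have False if less: "j < k" and ord: "has_order m p s I j" "has_order m p s I k" for j k
  proof -
    obtain c where c: "c \<in> carrier R" "c \<notin> m" "s [^] j \<otimes> c \<in> I" using ord by (auto simp: has_order_def)
    then have "s [^] j \<otimes> c \<in> PIdl p <+>\<^bsub>R\<^esub> PIdl (s [^] k)" using ord by (auto simp: has_order_def)
    then obtain u v where uv: "u \<in> carrier R" "v \<in> carrier R" "s [^] j \<otimes> c = u \<otimes> p \<oplus> v \<otimes> s [^] k"
      unfolding PIdl_sum_iff by blast
    \<comment> \<open>write \<open>v s\<^sup>k = s\<^sup>j (w s)\<close>, so that \<open>s\<^sup>j (c - w s)\<close> is a multiple of \<open>p\<close>\<close>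
    obtain i where i: "k = j + Suc i" using less less_iff_Suc_add by auto
    define S w where "S = s [^] j" and "w = v \<otimes> s [^] i"
    have Sw: "S \<in> carrier R" "w \<in> carrier R" using d uv by (simp_all add: S_def w_def)
    have "v \<otimes> s [^] k = S \<otimes> (w \<otimes> s)"
      using d(5) uv(1,2) unfolding i S_def w_def
      by (simp add: nat_pow_mult[symmetric] nat_pow_Suc m_ac)
    then have "S \<otimes> c = u \<otimes> p \<oplus> S \<otimes> (w \<otimes> s)" using uv by (simp add: S_def)
    moreover have "S \<otimes> (c \<ominus> w \<otimes> s) = S \<otimes> c \<ominus> S \<otimes> (w \<otimes> s)"
      using Sw d(5) c(1) by algebra
    moreover have "u \<otimes> p \<oplus> S \<otimes> (w \<otimes> s) \<ominus> S \<otimes> (w \<otimes> s) = u \<otimes> p"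
      using Sw d(4,5) uv(1) by algebra
    ultimately have "S \<otimes> (c \<ominus> w \<otimes> s) \<in> PIdl p" using uv(1) by (auto simp: PIdl_iff)
    moreover have "s [^] n \<notin> PIdl p" for n :: nat
    proof (induct n)
      case 0
      then show ?case using P.I_notcarr P.one_imp_carrier by auto
    next
      case (Suc n)
      then show ?case using P.I_prime[of "s [^] n" s] d by auto
    qed
    ultimately have "c \<ominus> w \<otimes> s \<in> PIdl p"
      using P.I_prime[of S "c \<ominus> w \<otimes> s"] Sw c d by (auto simp: S_def)
    also have "PIdl p \<subseteq> m" using prime_pair_mem(1)[OF mps] d(2) by (rule cgenideal_minimal[rotated])
    finally have "c \<ominus> w \<otimes> s \<in> m" .
    moreover have "w \<otimes> s \<in> m" using Sw prime_pair_mem(2)[OF mps] by (simp add: M.I_l_closed)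
    ultimately have "(c \<ominus> w \<otimes> s) \<oplus> w \<otimes> s \<in> m" by simp
    moreover have "(c \<ominus> w \<otimes> s) \<oplus> w \<otimes> s = c" using c(1) Sw d(5) by algebra
    ultimately show False using c by simp
  qed
  then show ?thesis using assms(2,3) by (metis nat_neq_iff)
qed

lemma has_order_self:
  assumes "prime_pair m p s"
  shows "has_order m p s m 1"
proof -
  note d = prime_pairD[OF assms]
  interpret M: maximalideal m R by (rule d)
  have "\<one> \<notin> m" using M.I_notcarr M.one_imp_carrier by blast
  moreover have "s [^] (1::nat) \<otimes> \<one> \<in> m" using prime_pair_mem[OF assms] d by simp
  moreover have "s [^] (1::nat) = s" using d by simp
  moreover have "m \<subseteq> PIdl p <+>\<^bsub>R\<^esub> PIdl s" using d(9) by (rule equalityD1)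
  ultimately show ?thesis unfolding has_order_def by (intro conjI bexI[of _ \<one>]) simp_all
qed

lemma has_order_0:
  assumes "prime_pair m p s" "ideal I R" "\<not> I \<subseteq> m"
  shows "has_order m p s I 0"
proof -
  note d = prime_pairD[OF assms(1)]
  interpret I: ideal I R by fact
  have "I \<subseteq> PIdl p <+>\<^bsub>R\<^esub> PIdl (s [^] (0::nat))"
  proof
    fix x assume "x \<in> I"
    then have "x = \<zero> \<otimes> p \<oplus> x \<otimes> s [^] (0::nat)" "x \<in> carrier R" using d by auto
    then show "x \<in> PIdl p <+>\<^bsub>R\<^esub> PIdl (s [^] (0::nat))" unfolding PIdl_sum_iff using zero_closed by blast
  qed
  moreover have "\<exists>c\<in>carrier R - m. s [^] (0::nat) \<otimes> c \<in> I" using assms(3) by auto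
  ultimately show ?thesis by (simp add: has_order_def)
qed

text \<open>
  \<open>f m\<close> is the order at \<open>m\<close> of an ideal representing the class. Orders depend on the representing
  ideal (multiplying it by \<open>p\<close> destroys them), so the representative is restricted to ideals without
  common denominator, among which it is unique.
\<close>

definition class_orders :: "'a set set \<Rightarrow> ('a set \<Rightarrow> nat) \<Rightarrow> bool" where
  "class_orders C f \<longleftrightarrow> (\<exists>I\<in>nonzero_ideals R. C = ideal_class R I \<and> no_common_denominator I \<and>
     (\<forall>m p s. prime_pair m p s \<longrightarrow> has_order m p s I (f m)))"

lemma class_orders_unique:
  assumes "class_orders C f" "class_orders C g" "prime_pair m p s"
  shows "f m = g m"
proof -
  obtain I where I: "I \<in> nonzero_ideals R" "C = ideal_class R I" "no_common_denominator I"
      "has_order m p s I (f m)"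
    using assms by (auto simp: class_orders_def)
  obtain J where J: "J \<in> nonzero_ideals R" "C = ideal_class R J" "no_common_denominator J"
      "has_order m p s J (g m)"
    using assms by (auto simp: class_orders_def)
  have "(I, J) \<in> ideal_class_rel R"
    using I J eq_equiv_class[OF _ equiv_ideal_class_rel] by (auto simp: ideal_class_def)
  then have "I = J" using I(3) J(3) by (rule ideal_class_rel_imp_eq)
  with I(4) J(4) show ?thesis by (simp add: has_order_unique[OF assms(3)])
qed

lemma class_orders_cong:
  assumes "class_orders C f" "\<And>m p s. prime_pair m p s \<Longrightarrow> f m = g m"
  shows "class_orders C g"
  using assms by (simp add: class_orders_def)

lemma class_orders_closed: "class_orders C f \<Longrightarrow> C \<in> carrier (ideal_class_monoid R)"
  by (auto simp: class_orders_def carrier_ideal_class_monoid)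

lemma class_orders_one: "class_orders \<one>\<^bsub>ideal_class_monoid R\<^esub> (\<lambda>_. 0)"
proof -
  have "has_order m p s (carrier R) 0" if "prime_pair m p s" for m p s
  proof -
    interpret M: maximalideal m R using that by (rule prime_pairD)
    show ?thesis using that M.I_notcarr M.a_subset by (intro has_order_0 oneideal) auto
  qed
  then show ?thesis
    unfolding class_orders_def using nonzero_ideals_carrier no_common_denominator_carrier
    by (auto simp: ideal_class_monoid_def)
qed

lemma class_orders_mult:
  assumes "class_orders C f" "class_orders D g"
  shows "class_orders (C \<otimes>\<^bsub>ideal_class_monoid R\<^esub> D) (\<lambda>m. f m + g m)"
proof -
  obtain I where I: "I \<in> nonzero_ideals R" "C = ideal_class R I" "no_common_denominator I"
      "\<And>m p s. prime_pair m p s \<Longrightarrow> has_order m p s I (f m)"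
    using assms unfolding class_orders_def by blast
  obtain J where J: "J \<in> nonzero_ideals R" "D = ideal_class R J" "no_common_denominator J"
      "\<And>m p s. prime_pair m p s \<Longrightarrow> has_order m p s J (g m)"
    using assms unfolding class_orders_def by blast
  have id: "ideal I R" "ideal J R" using I J by (auto intro: nonzero_ideals_ideal)
  show ?thesis
    unfolding class_orders_def
  proof (intro bexI[of _ "I \<cdot> J"] conjI allI impI)
    show "I \<cdot> J \<in> nonzero_ideals R" using I J by (simp add: nonzero_ideals_prod)
    show "C \<otimes>\<^bsub>ideal_class_monoid R\<^esub> D = ideal_class R (I \<cdot> J)" using I J by (simp add: ideal_class_mult)
    show "no_common_denominator (I \<cdot> J)" using I J id by (simp add: no_common_denominator_prod)
    fix m p s assume "prime_pair m p s"
    then show "has_order m p s (I \<cdot> J) (f m + g m)" using I J id by (simp add: has_order_prod)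
  qed
qed

lemma class_orders_maximal:
  assumes "prime_pair n q r"
  shows "class_orders (ideal_class R n) (\<lambda>m. if m = n then 1 else 0)"
  unfolding class_orders_def
proof (intro bexI[of _ n] conjI allI impI)
  show "n \<in> nonzero_ideals R" "no_common_denominator n"
    using assms by (rule prime_pair_nonzero no_common_denominator_prime_pair)+
  fix m p s assume mps: "prime_pair m p s"
  show "has_order m p s n (if m = n then 1 else 0)"
  proof (cases "m = n")
    case True
    then show ?thesis using mps has_order_self by auto
  next
    case False
    interpret N: maximalideal n R using assms by (rule prime_pairD)
    interpret M: maximalideal m R using mps by (rule prime_pairD)
    have "\<not> n \<subseteq> m"
      using N.I_maximal[OF M.is_ideal _ M.a_subset] M.I_notcarr False by blast
    then show ?thesis using False mps N.is_ideal by (simp add: has_order_0)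
  qed
qed simp

lemma class_orders_pow:
  assumes "class_orders C f"
  shows "class_orders (C [^]\<^bsub>ideal_class_monoid R\<^esub> (n::nat)) (\<lambda>m. n * f m)"
proof (induct n)
  case 0
  then show ?case using class_orders_one by (simp add: Group.nat_pow_0)
next
  case (Suc n)
  then show ?case using class_orders_mult[OF Suc assms] by (simp add: nat_pow_def add.commute)
qed

text \<open>
  By additivity, the orders of a product of classes of maximal ideals are its exponents, and a class
  determines its orders.
\<close>

theorem maximal_ideal_classes_basis:
  assumes two_gen: "\<And>m. maximalideal m R \<Longrightarrow> \<exists>p s. prime_pair m p s"
  defines "M \<equiv> ideal_class_monoid R" and "B \<equiv> ideal_class R ` {m. maximalideal m R}"
  shows "inj_on (ideal_class R) {m. maximalideal m R}"
    and "free_submonoid_basis M (power_prod M ` carrier (free_comm_monoid B)) B"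
proof -
  interpret M: comm_monoid M unfolding M_def by (rule comm_monoid_ideal_class_monoid)
  have one: "class_orders (ideal_class R n) (\<lambda>m. if m = n then 1 else 0)" if "maximalideal n R" for n
    using two_gen[OF that] class_orders_maximal by blast
  show inj: "inj_on (ideal_class R) {m. maximalideal m R}"
  proof (rule inj_onI)
    fix m n assume mn: "m \<in> {m. maximalideal m R}" "n \<in> {m. maximalideal m R}"
      and eq: "ideal_class R m = ideal_class R n"
    obtain p s where "prime_pair m p s" using mn two_gen by blast
    then have "(if m = m then 1 else 0 :: nat) = (if m = n then 1 else 0)"
      using class_orders_unique[OF one[of m]] one[of n] mn eq by fastforce
    then show "m = n" by (simp split: if_splits)
  qed
  have B: "B \<subseteq> carrier M" using one class_orders_closed unfolding B_def M_def by blast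
  have prod: "class_orders (\<Otimes>\<^bsub>M\<^esub>b\<in>A. b [^]\<^bsub>M\<^esub> (f b :: nat))
      (\<lambda>m. if ideal_class R m \<in> A then f (ideal_class R m) else 0)"
    if "finite A" "A \<subseteq> B" for A f
    using that
  proof (induct A)
    case empty
    then show ?case using class_orders_one by (simp add: M_def[symmetric])
  next
    case (insert b A)
    then obtain n where n: "maximalideal n R" "b = ideal_class R n" by (auto simp: B_def)
    have "class_orders (b [^]\<^bsub>M\<^esub> f b \<otimes>\<^bsub>M\<^esub> (\<Otimes>\<^bsub>M\<^esub>b\<in>A. b [^]\<^bsub>M\<^esub> f b))
        (\<lambda>m. f b * (if m = n then 1 else 0) + (if ideal_class R m \<in> A then f (ideal_class R m) else 0))"
      using insert one[OF n(1)] unfolding M_def n(2) by (intro class_orders_mult class_orders_pow) auto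
    moreover have "(\<Otimes>\<^bsub>M\<^esub>b\<in>insert b A. b [^]\<^bsub>M\<^esub> f b) = b [^]\<^bsub>M\<^esub> f b \<otimes>\<^bsub>M\<^esub> (\<Otimes>\<^bsub>M\<^esub>b\<in>A. b [^]\<^bsub>M\<^esub> f b)"
      using insert B by (intro M.finprod_insert) auto
    ultimately have "class_orders (\<Otimes>\<^bsub>M\<^esub>b\<in>insert b A. b [^]\<^bsub>M\<^esub> f b)
        (\<lambda>m. f b * (if m = n then 1 else 0) + (if ideal_class R m \<in> A then f (ideal_class R m) else 0))"
      by simp
    then show ?case
    proof (rule class_orders_cong)
      fix m p s assume "prime_pair m p s"
      then have "maximalideal m R" by (rule prime_pairD)
      then have "ideal_class R m = b \<longleftrightarrow> m = n" using inj n by (auto simp: inj_on_def)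
      then show "f b * (if m = n then 1 else 0) + (if ideal_class R m \<in> A then f (ideal_class R m) else 0)
          = (if ideal_class R m \<in> insert b A then f (ideal_class R m) else 0)"
        using insert(2) by auto
    qed
  qed
  have orders: "class_orders (power_prod M f) (\<lambda>m. Poly_Mapping.lookup f (ideal_class R m))"
    if "f \<in> carrier (free_comm_monoid B)" for f
    unfolding power_prod_def
    by (rule class_orders_cong[OF prod]) (use that in \<open>auto simp: free_comm_monoid_def in_keys_iff\<close>)
  have "inj_on (power_prod M) (carrier (free_comm_monoid B))"
  proof (intro inj_onI poly_mapping_eqI)
    fix f g b assume f: "f \<in> carrier (free_comm_monoid B)" and g: "g \<in> carrier (free_comm_monoid B)"
      and eq: "power_prod M f = power_prod M g"
    show "Poly_Mapping.lookup f b = Poly_Mapping.lookup g b"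
    proof (cases "b \<in> B")
      case True
      then obtain m where m: "maximalideal m R" "b = ideal_class R m" by (auto simp: B_def)
      then obtain p s where "prime_pair m p s" using two_gen by blast
      then show ?thesis using class_orders_unique[OF orders[OF f]] orders[OF g] eq m by simp
    next
      case False
      then have "b \<notin> Poly_Mapping.keys f" "b \<notin> Poly_Mapping.keys g"
        using f g by (auto simp: free_comm_monoid_def)
      then show ?thesis by (simp add: in_keys_iff)
    qed
  qed
  then show "free_submonoid_basis M (power_prod M ` carrier (free_comm_monoid B)) B"
    by (rule M.free_submonoid_basisI[OF B])
qed

end


section \<open>Laurent polynomials modulo a prime number or zero\<close>

lemma lookup_mult_int:
  fixes f g :: "int \<Rightarrow>\<^sub>0 int"
  shows "Poly_Mapping.lookup (f * g) n =
    (\<Sum>k\<in>Poly_Mapping.keys f. Poly_Mapping.lookup f k * Poly_Mapping.lookup g (n - k))"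
proof -
  have "Sum_any (\<lambda>q. Poly_Mapping.lookup g q when n = k + q) = Poly_Mapping.lookup g (n - k)" for k
  proof -
    have "(\<lambda>q. Poly_Mapping.lookup g q when n = k + q) = (\<lambda>q. Poly_Mapping.lookup g q when q = n - k)"
      by (auto simp: when_def fun_eq_iff)
    then show ?thesis by (simp only: Sum_any_when_equal)
  qed
  then have "Poly_Mapping.lookup (f * g) n =
      Sum_any (\<lambda>k. Poly_Mapping.lookup f k * Poly_Mapping.lookup g (n - k))"
    by (simp add: lookup_mult)
  also have "\<dots> = (\<Sum>k\<in>Poly_Mapping.keys f. Poly_Mapping.lookup f k * Poly_Mapping.lookup g (n - k))"
    by (rule Sum_any.expand_superset) (auto simp: in_keys_iff)
  finally show ?thesis .
qed

lemma lookup_single_mult_int: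
  fixes f :: "int \<Rightarrow>\<^sub>0 int"
  shows "Poly_Mapping.lookup (Poly_Mapping.single e c * f) k = c * Poly_Mapping.lookup f (k - e)"
  by (simp add: lookup_mult_int)

text \<open>
  The set of exponents of the Laurent polynomial over \<open>\<int>/p\<close> obtained by reduction. For \<open>p = 0\<close>
  this is the usual support, since 0 divides only 0; the cases of a prime number and of 0
  are treated together throughout.
\<close>

definition supp_mod :: "int \<Rightarrow> (int \<Rightarrow>\<^sub>0 int) \<Rightarrow> int set" where
  "supp_mod p f = {k. \<not> p dvd Poly_Mapping.lookup f k}"

lemma finite_supp_mod [simp]: "finite (supp_mod p f)"
  by (rule finite_subset[of _ "Poly_Mapping.keys f"]) (auto simp: supp_mod_def in_keys_iff)

lemma supp_mod_bounds: "k \<in> supp_mod p f \<Longrightarrow> Min (supp_mod p f) \<le> k \<and> k \<le> Max (supp_mod p f)"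
  by simp

lemma supp_mod_empty_iff: "supp_mod p f = {} \<longleftrightarrow> (\<exists>h. f = Poly_Mapping.single 0 p * h)"
proof
  assume S: "supp_mod p f = {}"
  have "f = Poly_Mapping.single 0 p * Poly_Mapping.map (\<lambda>c. c div p) f"
  proof (rule poly_mapping_eqI)
    fix k
    have "p dvd Poly_Mapping.lookup f k" using S by (auto simp: supp_mod_def)
    then show "Poly_Mapping.lookup f k =
        Poly_Mapping.lookup (Poly_Mapping.single 0 p * Poly_Mapping.map (\<lambda>c. c div p) f) k"
      by (simp add: lookup_single_mult_int map.rep_eq when_def)
  qed
  then show "\<exists>h. f = Poly_Mapping.single 0 p * h" by blast
qed (auto simp: supp_mod_def lookup_single_mult_int)

lemma supp_mod_one: "\<not> p dvd 1 \<Longrightarrow> supp_mod p 1 = {0}"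
  by (auto simp: supp_mod_def lookup_one when_def)

lemma supp_mod_minus_multiple: "supp_mod p (f - Poly_Mapping.single 0 p * h) = supp_mod p f"
  by (auto simp: supp_mod_def lookup_minus lookup_single_mult_int dvd_diff_left_iff)

lemma supp_mod_single_mult:
  assumes "p = 0 \<or> prime p" "\<not> p dvd c"
  shows "supp_mod p (Poly_Mapping.single 0 c * f) = supp_mod p f"
  using assms by (auto simp: supp_mod_def lookup_single_mult_int prime_dvd_mult_iff)

text \<open>
  The coefficient of the product at \<open>a + b\<close> is the product of two coefficients not divisible by \<open>p\<close> if
  no other pair of exponents contributes modulo \<open>p\<close>. Both pairs of extreme exponents are of this kind.
\<close>

lemma supp_mod_mult_unique:
  assumes p: "p = 0 \<or> prime p" and a: "a \<in> supp_mod p f" and b: "b \<in> supp_mod p g"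
    and unique: "\<And>k l. \<lbrakk>k \<in> supp_mod p f; l \<in> supp_mod p g; k + l = a + b\<rbrakk> \<Longrightarrow> k = a"
  shows "a + b \<in> supp_mod p (f * g)"
proof -
  let ?F = "Poly_Mapping.lookup f" and ?G = "Poly_Mapping.lookup g"
  have "a \<in> Poly_Mapping.keys f" using a by (auto simp: supp_mod_def in_keys_iff)
  then have "Poly_Mapping.lookup (f * g) (a + b) =
      ?F a * ?G b + (\<Sum>k\<in>Poly_Mapping.keys f - {a}. ?F k * ?G (a + b - k))"
    by (simp add: lookup_mult_int sum.remove)
  moreover have "p dvd (\<Sum>k\<in>Poly_Mapping.keys f - {a}. ?F k * ?G (a + b - k))"
  proof (rule dvd_sum)
    fix k assume "k \<in> Poly_Mapping.keys f - {a}"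
    then have "k \<notin> supp_mod p f \<or> a + b - k \<notin> supp_mod p g" using unique[of k "a + b - k"] by auto
    then show "p dvd ?F k * ?G (a + b - k)" by (auto simp: supp_mod_def)
  qed
  moreover have "\<not> p dvd ?F a * ?G b"
    using p a b by (auto simp: supp_mod_def prime_dvd_mult_iff)
  ultimately show ?thesis by (simp add: supp_mod_def dvd_add_left_iff)
qed

lemma supp_mod_mult_extremes:
  assumes p: "p = 0 \<or> prime p" and ne: "supp_mod p f \<noteq> {}" "supp_mod p g \<noteq> {}"
  shows "Max (supp_mod p f) + Max (supp_mod p g) \<in> supp_mod p (f * g)"
    and "Min (supp_mod p f) + Min (supp_mod p g) \<in> supp_mod p (f * g)"
proof -
  show "Max (supp_mod p f) + Max (supp_mod p g) \<in> supp_mod p (f * g)"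
  proof (rule supp_mod_mult_unique[OF p])
    show "Max (supp_mod p f) \<in> supp_mod p f" "Max (supp_mod p g) \<in> supp_mod p g" using ne by auto
    show "k = Max (supp_mod p f)" if "k \<in> supp_mod p f" "l \<in> supp_mod p g"
      "k + l = Max (supp_mod p f) + Max (supp_mod p g)" for k l
      using that supp_mod_bounds[of k p f] supp_mod_bounds[of l p g] by linarith
  qed
  show "Min (supp_mod p f) + Min (supp_mod p g) \<in> supp_mod p (f * g)"
  proof (rule supp_mod_mult_unique[OF p])
    show "Min (supp_mod p f) \<in> supp_mod p f" "Min (supp_mod p g) \<in> supp_mod p g" using ne by auto
    show "k = Min (supp_mod p f)" if "k \<in> supp_mod p f" "l \<in> supp_mod p g"
      "k + l = Min (supp_mod p f) + Min (supp_mod p g)" for k l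
      using that supp_mod_bounds[of k p f] supp_mod_bounds[of l p g] by linarith
  qed
qed

text \<open>
  Over a domain, only monomials divide monomials in the Laurent polynomial ring.
\<close>

lemma supp_mod_mult_singleton:
  assumes p: "p = 0 \<or> prime p" and S: "supp_mod p (f * g) = {n}"
  shows "\<exists>a. supp_mod p f = {a}"
proof -
  have f: "supp_mod p f \<noteq> {}"
    using S supp_mod_empty_iff[of p f] supp_mod_empty_iff[of p "f * g"] by (metis insert_not_empty mult.assoc)
  have g: "supp_mod p g \<noteq> {}"
    using S supp_mod_empty_iff[of p g] supp_mod_empty_iff[of p "f * g"]
    by (metis insert_not_empty mult.left_commute)
  let ?M = "Max (supp_mod p f)" and ?m = "Min (supp_mod p f)"
  have "?M + Max (supp_mod p g) = ?m + Min (supp_mod p g)"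
    using supp_mod_mult_extremes[OF p f g] S by auto
  moreover have "Min (supp_mod p g) \<le> Max (supp_mod p g)" using g by simp
  ultimately have "?M \<le> ?m" by linarith
  moreover have "?m \<le> k" "k \<le> ?M" if "k \<in> supp_mod p f" for k using that by auto
  ultimately have "k = ?m" if "k \<in> supp_mod p f" for k using that by (meson order.antisym order.trans)
  then show ?thesis using f by blast
qed

definition width :: "int \<Rightarrow> (int \<Rightarrow>\<^sub>0 int) \<Rightarrow> nat" where
  "width p f = nat (Max (supp_mod p f) - Min (supp_mod p f))"

text \<open>
  One division step multiplies \<open>g\<close> by the leading coefficient \<open>a\<close> of \<open>f\<close> and subtracts the monomial
  multiple of \<open>f\<close> that cancels the leading term. The width decreases because the width of \<open>f\<close> is at
  most that of \<open>g\<close>, so the subtracted multiple does not reach below the lowest exponent of \<open>g\<close>. By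
  minimality of \<open>f\<close> the process stops only at an element that vanishes modulo \<open>p\<close>.
\<close>

lemma pseudo_division:
  fixes I :: "(int \<Rightarrow>\<^sub>0 int) set"
  assumes add: "\<And>a b. \<lbrakk>a \<in> I; b \<in> I\<rbrakk> \<Longrightarrow> a + b \<in> I" and mult: "\<And>r a. a \<in> I \<Longrightarrow> r * a \<in> I"
    and f: "f \<in> I" "supp_mod p f \<noteq> {}"
    and minimal: "\<And>g. \<lbrakk>g \<in> I; supp_mod p g \<noteq> {}\<rbrakk> \<Longrightarrow> width p f \<le> width p g"
    and a: "a = Poly_Mapping.lookup f (Max (supp_mod p f))"
    and g: "g \<in> I"
  shows "\<exists>k q r. Poly_Mapping.single 0 (a ^ k) * g = q * f + Poly_Mapping.single 0 p * r"
  using g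
\<comment> \<open>elements that vanish modulo \<open>p\<close> get the measure 0, below that of a monomial, whose width is 0\<close>
proof (induct "if supp_mod p g = {} then 0 else Suc (width p g)" arbitrary: g rule: less_induct)
  case less
  show ?case
  proof (cases "supp_mod p g = {}")
    case True
    then obtain h where "g = Poly_Mapping.single 0 p * h" by (auto simp: supp_mod_empty_iff)
    then have "Poly_Mapping.single 0 (a ^ 0) * g = 0 * f + Poly_Mapping.single 0 p * h"
      by simp
    then show ?thesis by blast
  next
    case False
    let ?Mf = "Max (supp_mod p f)" and ?mf = "Min (supp_mod p f)"
    let ?Mg = "Max (supp_mod p g)" and ?mg = "Min (supp_mod p g)"
    define c where "c = Poly_Mapping.lookup g ?Mg"
    define e where "e = ?Mg - ?Mf"
    define h where "h = Poly_Mapping.single 0 a * g + Poly_Mapping.single e (- c) * f"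
    have h_in: "h \<in> I" unfolding h_def by (intro add mult f less.prems)
    have lookup_h: "Poly_Mapping.lookup h k =
        a * Poly_Mapping.lookup g k - c * Poly_Mapping.lookup f (k - e)" for k
      by (simp add: h_def lookup_add lookup_single_mult_int)
    have "?mg \<le> ?Mg" "?mf \<le> ?Mf" using f(2) False by simp_all
    then have w: "?Mf - ?mf \<le> ?Mg - ?mg" "?mg \<le> ?Mg" "?mf \<le> ?Mf"
      using minimal[OF less.prems False] unfolding width_def by linarith+
    have range_h: "?mg \<le> k \<and> k < ?Mg" if k: "k \<in> supp_mod p h" for k
    proof (rule ccontr)
      assume out: "\<not> (?mg \<le> k \<and> k < ?Mg)"
      show False
      proof (cases "k = ?Mg")
        case True
        then have "Poly_Mapping.lookup h k = 0" by (simp add: lookup_h e_def c_def a)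
        then show False using k by (simp add: supp_mod_def)
      next
        case False
        have "k \<notin> supp_mod p g" using out False supp_mod_bounds[of k p g] by linarith
        moreover have "k - e \<notin> supp_mod p f"
          using out False w supp_mod_bounds[of "k - e" p f] unfolding e_def by linarith
        ultimately have "p dvd Poly_Mapping.lookup h k" by (simp add: lookup_h supp_mod_def)
        then show False using k by (simp add: supp_mod_def)
      qed
    qed
    have "(if supp_mod p h = {} then 0 else Suc (width p h)) < Suc (width p g)"
    proof (cases "supp_mod p h = {}")
      case h: False
      have "Max (supp_mod p h) < ?Mg" "?mg \<le> Min (supp_mod p h)" "Min (supp_mod p h) \<le> Max (supp_mod p h)"
        using range_h Max_in[OF finite_supp_mod h] Min_in[OF finite_supp_mod h] h by auto
      then have "width p h < width p g" unfolding width_def by linarith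
      then show ?thesis using h by simp
    qed simp
    then obtain k q r where kqr: "Poly_Mapping.single 0 (a ^ k) * h = q * f + Poly_Mapping.single 0 p * r"
      using less.hyps[OF _ h_in] False by auto
    have "Poly_Mapping.single 0 (a ^ Suc k) * g =
        Poly_Mapping.single 0 (a ^ k) * (Poly_Mapping.single 0 a * g)"
      by (simp add: mult.assoc[symmetric] mult_single mult.commute)
    also have "Poly_Mapping.single 0 a * g = h + Poly_Mapping.single e c * f"
      by (simp add: h_def algebra_simps single_uminus)
    also have "Poly_Mapping.single 0 (a ^ k) * \<dots> =
        (q + Poly_Mapping.single 0 (a ^ k) * Poly_Mapping.single e c) * f + Poly_Mapping.single 0 p * r"
      using kqr by (simp add: algebra_simps)
    finally show ?thesis by blast
  qed
qed


section \<open>Maximal ideals of the ring of integral Laurent polynomials\<close>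

lemma int_laurent_ring_simps [simp]:
  "carrier int_laurent_ring = UNIV" "x \<otimes>\<^bsub>int_laurent_ring\<^esub> y = x * y" "\<one>\<^bsub>int_laurent_ring\<^esub> = 1"
  "\<zero>\<^bsub>int_laurent_ring\<^esub> = 0" "x \<oplus>\<^bsub>int_laurent_ring\<^esub> y = x + y"
  by (simp_all add: int_laurent_ring_def ring_of_type_algebra_def)

interpretation laurent: domain int_laurent_ring
  by (rule domain_int_laurent_ring)

lemma ideal_laurent_iff:
  "ideal I int_laurent_ring \<longleftrightarrow> 0 \<in> I \<and> (\<forall>a\<in>I. \<forall>b\<in>I. a + b \<in> I) \<and> (\<forall>r. \<forall>a\<in>I. r * a \<in> I)"
proof
  assume "ideal I int_laurent_ring"
  then interpret ideal I int_laurent_ring .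
  show "0 \<in> I \<and> (\<forall>a\<in>I. \<forall>b\<in>I. a + b \<in> I) \<and> (\<forall>r. \<forall>a\<in>I. r * a \<in> I)"
    using zero_closed a_closed I_l_closed by simp
next
  assume *: "0 \<in> I \<and> (\<forall>a\<in>I. \<forall>b\<in>I. a + b \<in> I) \<and> (\<forall>r. \<forall>a\<in>I. r * a \<in> I)"
  have inv: "\<ominus>\<^bsub>int_laurent_ring\<^esub> a = - a" for a
    by (rule laurent.minus_equality) simp_all
  show "ideal I int_laurent_ring"
  proof (rule idealI)
    show "ring int_laurent_ring" by (rule laurent.ring_axioms)
    show "subgroup I (add_monoid int_laurent_ring)"
    proof (rule group.subgroupI[OF laurent.a_group])
      fix a assume "a \<in> I"
      then have "- 1 * a \<in> I" using * by blast
      then show "inv\<^bsub>add_monoid int_laurent_ring\<^esub> a \<in> I" using inv[of a] by (simp add: a_inv_def)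
    qed (use * in auto)
    fix a x assume "a \<in> I"
    then have "x * a \<in> I" using * by blast
    then show "x \<otimes>\<^bsub>int_laurent_ring\<^esub> a \<in> I" "a \<otimes>\<^bsub>int_laurent_ring\<^esub> x \<in> I"
      by (simp_all add: mult.commute)
  qed
qed

lemma maximal_laurentD:
  assumes m: "maximalideal m int_laurent_ring"
  shows "a \<in> m \<Longrightarrow> b \<in> m \<Longrightarrow> a + b \<in> m" "a \<in> m \<Longrightarrow> r * a \<in> m" "1 \<notin> m"
    "a * b \<in> m \<Longrightarrow> a \<in> m \<or> b \<in> m"
    "a \<notin> m \<Longrightarrow> \<exists>h. 1 - h * a \<in> m"
proof -
  interpret m: maximalideal m int_laurent_ring by (rule m)
  interpret p: primeideal m int_laurent_ring by (rule laurent.maximalideal_prime[OF m])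
  have id: "0 \<in> m \<and> (\<forall>a\<in>m. \<forall>b\<in>m. a + b \<in> m) \<and> (\<forall>r. \<forall>a\<in>m. r * a \<in> m)"
    using m.is_ideal by (simp add: ideal_laurent_iff)
  show "a \<in> m \<Longrightarrow> b \<in> m \<Longrightarrow> a + b \<in> m" "a \<in> m \<Longrightarrow> r * a \<in> m" using id by auto
  show "1 \<notin> m" using m.I_notcarr m.one_imp_carrier by auto
  show "a * b \<in> m \<Longrightarrow> a \<in> m \<or> b \<in> m" using p.I_prime by simp
  assume a: "a \<notin> m"
  let ?J = "{h * a + b | h b. b \<in> m}"
  have "ideal ?J int_laurent_ring"
    unfolding ideal_laurent_iff
  proof (intro conjI ballI allI)
    show "0 \<in> ?J" using id by (force intro: exI[of _ 0])
    fix x assume "x \<in> ?J"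
    then obtain h b where x: "x = h * a + b" "b \<in> m" by blast
    have "r * x = (r * h) * a + r * b" for r using x by (simp add: algebra_simps)
    then show "r * x \<in> ?J" for r using x id by blast
    fix y assume "y \<in> ?J"
    then obtain h' b' where y: "y = h' * a + b'" "b' \<in> m" by blast
    have "x + y = (h + h') * a + (b + b')" using x y by (simp add: algebra_simps)
    then show "x + y \<in> ?J" using x y id by blast
  qed
  moreover have "m \<subseteq> ?J" by (force intro: exI[of _ 0])
  moreover have "a \<in> ?J" using id by (force intro: exI[of _ 1] exI[of _ 0])
  ultimately have "?J = UNIV" using m.I_maximal[of ?J] a by auto
  then have "1 \<in> ?J" by simp
  then obtain h b where hb: "1 = h * a + b" "b \<in> m" by blast
  have "1 - h * a \<in> m" using hb(2) by (subst hb(1)) simp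
  then show "\<exists>h. 1 - h * a \<in> m" ..
qed

lemma PIdl_laurent: "PIdl\<^bsub>int_laurent_ring\<^esub> (Poly_Mapping.single 0 p) = {f. supp_mod p f = {}}"
  by (auto simp: cgenideal_def supp_mod_empty_iff mult.commute)

lemma prime_or_zero_not_dvd_one: "p = 0 \<or> prime (p :: int) \<Longrightarrow> \<not> p dvd 1"
  by (auto dest: not_prime_unit)

lemma primeideal_laurent:
  assumes p: "p = 0 \<or> prime p"
  shows "primeideal (PIdl\<^bsub>int_laurent_ring\<^esub> (Poly_Mapping.single 0 p)) int_laurent_ring"
proof (rule primeidealI)
  show "ideal (PIdl\<^bsub>int_laurent_ring\<^esub> (Poly_Mapping.single 0 p)) int_laurent_ring"
    by (rule laurent.cgenideal_ideal) simp
  show "cring int_laurent_ring" by (rule laurent.is_cring)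
  show "carrier int_laurent_ring \<noteq> PIdl\<^bsub>int_laurent_ring\<^esub> (Poly_Mapping.single 0 p)"
    using supp_mod_one[of p] prime_or_zero_not_dvd_one[OF p] by (auto simp: PIdl_laurent)
  fix a b assume "a \<otimes>\<^bsub>int_laurent_ring\<^esub> b \<in> PIdl\<^bsub>int_laurent_ring\<^esub> (Poly_Mapping.single 0 p)"
  then show "a \<in> PIdl\<^bsub>int_laurent_ring\<^esub> (Poly_Mapping.single 0 p) \<or>
      b \<in> PIdl\<^bsub>int_laurent_ring\<^esub> (Poly_Mapping.single 0 p)"
    using supp_mod_mult_extremes(1)[OF p, of a b] by (auto simp: PIdl_laurent)
qed

text \<open>
  Otherwise \<open>m \<subseteq> (p)\<close>, and then \<open>1 + t\<close>, which is not in \<open>m\<close>, would be a unit modulo \<open>p\<close>. But the units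
  of the Laurent polynomials over a domain are monomials.
\<close>

lemma maximal_has_supp_mod:
  assumes m: "maximalideal m int_laurent_ring" and p: "p = 0 \<or> prime p"
  shows "\<exists>f\<in>m. supp_mod p f \<noteq> {}"
proof (rule ccontr)
  assume no: "\<not> ?thesis"
  define f :: "int \<Rightarrow>\<^sub>0 int" where "f = 1 + Poly_Mapping.single 1 1"
  have f: "supp_mod p f = {0, 1}"
    using prime_or_zero_not_dvd_one[OF p]
    by (auto simp: f_def supp_mod_def lookup_add lookup_one lookup_single when_def)
  then have "f \<notin> m" using no by auto
  then obtain h where "1 - h * f \<in> m" using maximal_laurentD(5)[OF m] by blast
  then obtain r where "1 - h * f = Poly_Mapping.single 0 p * r"
    using no by (auto simp: supp_mod_empty_iff)
  then have "f * h = 1 - Poly_Mapping.single 0 p * r" by (simp add: algebra_simps)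
  then have "supp_mod p (f * h) = {0}"
    using prime_or_zero_not_dvd_one[OF p] by (simp add: supp_mod_minus_multiple supp_mod_one)
  then show False using supp_mod_mult_singleton[OF p] f by fastforce
qed

lemma maximal_min_width:
  assumes m: "maximalideal m int_laurent_ring" and p: "p = 0 \<or> prime p"
  obtains f where "f \<in> m" "supp_mod p f \<noteq> {}"
    "\<And>g. g \<in> m \<Longrightarrow> \<exists>k q r. Poly_Mapping.single 0 (Poly_Mapping.lookup f (Max (supp_mod p f)) ^ k) * g =
        q * f + Poly_Mapping.single 0 p * r"
proof -
  define f where "f = arg_min (width p) (\<lambda>f. f \<in> m \<and> supp_mod p f \<noteq> {})"
  obtain f0 where f0: "f0 \<in> m \<and> supp_mod p f0 \<noteq> {}" using maximal_has_supp_mod[OF m p] by blast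
  note f = arg_min_nat_lemma[of "\<lambda>f. f \<in> m \<and> supp_mod p f \<noteq> {}", OF f0, of "width p", folded f_def]
  show ?thesis
  proof (rule that[of f])
    fix g assume "g \<in> m"
    then show "\<exists>k q r. Poly_Mapping.single 0 (Poly_Mapping.lookup f (Max (supp_mod p f)) ^ k) * g =
        q * f + Poly_Mapping.single 0 p * r"
      using f by (intro pseudo_division[of m]) (auto intro: maximal_laurentD(1,2)[OF m])
  qed (use f in auto)
qed

lemma maximal_contains_prime_of_int:
  assumes m: "maximalideal m int_laurent_ring" and n: "Poly_Mapping.single 0 n \<in> m" "n \<noteq> 0"
  shows "\<exists>p. prime p \<and> Poly_Mapping.single 0 p \<in> m"
  using n(2,1)
proof (induct n rule: prime_divisors_induct)
  case zero
  then show ?case by simp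
next
  case (unit x)
  then obtain y where "x * y = 1" by (metis dvdE)
  then have "Poly_Mapping.single 0 y * Poly_Mapping.single 0 x = (1 :: int \<Rightarrow>\<^sub>0 int)"
    by (simp add: mult_single mult.commute)
  then show ?case
    using maximal_laurentD(2)[OF m unit(3), of "Poly_Mapping.single 0 y"] maximal_laurentD(3)[OF m] by simp
next
  case (factor p x)
  have "Poly_Mapping.single 0 p * Poly_Mapping.single 0 x \<in> m" using factor by (simp add: mult_single)
  then show ?case using factor maximal_laurentD(4)[OF m] by auto
qed

text \<open>
  The residue field of a maximal ideal has positive characteristic. If it did not, division by an
  element \<open>f\<close> of least width would take place over \<open>\<int>\<close>, and inverting a prime number \<open>q\<close> modulo \<open>m\<close>
  would make \<open>f\<close> divide \<open>a\<^sup>k (1 - q h)\<close>, which is a nonzero constant modulo \<open>q\<close>. Choosing \<open>q\<close> prime to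
  both extreme coefficients keeps the width of \<open>f\<close> visible modulo \<open>q\<close>.
\<close>

lemma maximal_contains_prime:
  assumes m: "maximalideal m int_laurent_ring"
  obtains p where "prime p" "Poly_Mapping.single 0 p \<in> m"
proof -
  have "\<exists>n. n \<noteq> 0 \<and> Poly_Mapping.single 0 n \<in> m"
  proof (rule ccontr)
    assume no: "\<not> ?thesis"
    obtain f where f: "f \<in> m" "supp_mod 0 f \<noteq> {}"
      and div: "\<And>g. g \<in> m \<Longrightarrow> \<exists>k q r. Poly_Mapping.single 0 (Poly_Mapping.lookup f (Max (supp_mod 0 f)) ^ k) * g =
        q * f + Poly_Mapping.single 0 0 * r"
      using maximal_min_width[OF m, of 0] by blast
    define A B where "A = Max (supp_mod 0 f)" and "B = Min (supp_mod 0 f)"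
    define a b where "a = Poly_Mapping.lookup f A" and "b = Poly_Mapping.lookup f B"
    have AB: "A \<in> supp_mod 0 f" "B \<in> supp_mod 0 f" using f(2) by (simp_all add: A_def B_def)
    then have ab: "a \<noteq> 0" "b \<noteq> 0" by (auto simp: a_def b_def supp_mod_def)
    obtain q :: int where q: "prime q" "\<not> q dvd a * b"
    proof -
      obtain q :: nat where "prime q" "nat \<bar>a * b\<bar> < q" using bigger_prime by blast
      moreover have "\<not> int q dvd a * b"
      proof
        assume "int q dvd a * b"
        then have "int q \<le> \<bar>a * b\<bar>" using ab by (intro zdvd_imp_le) auto
        then show False using \<open>nat \<bar>a * b\<bar> < q\<close> by linarith
      qed
      ultimately show ?thesis using that[of "int q"] by simp
    qed
    have "q \<noteq> 0" using q(1) by auto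
    then have "Poly_Mapping.single 0 q \<notin> m" using no by blast
    then obtain h where h: "1 - h * Poly_Mapping.single 0 q \<in> m" using maximal_laurentD(5)[OF m] by blast
    then obtain k Q where "Poly_Mapping.single 0 (a ^ k) * (1 - h * Poly_Mapping.single 0 q) = Q * f"
      using div[OF h] by (auto simp: a_def A_def)
    then have eq: "f * Q = Poly_Mapping.single 0 (a ^ k) * (1 - Poly_Mapping.single 0 q * h)"
      by (simp add: mult.commute)
    have "\<not> q dvd a ^ k" using q by (auto dest: prime_dvd_power)
    then have "supp_mod q (f * Q) = {0}"
      using q prime_or_zero_not_dvd_one[of q]
      by (simp add: eq supp_mod_single_mult supp_mod_minus_multiple supp_mod_one)
    then obtain c where "supp_mod q f = {c}" using supp_mod_mult_singleton[of q] q by blast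
    moreover have "A \<in> supp_mod q f" "B \<in> supp_mod q f" using q by (auto simp: supp_mod_def a_def b_def)
    ultimately have "A = B" by auto
    moreover have "B \<le> k" "k \<le> A" if "k \<in> supp_mod 0 f" for k using that by (auto simp: A_def B_def)
    ultimately have keys: "k = A" if "Poly_Mapping.lookup f k \<noteq> 0" for k
      using that by (force simp: supp_mod_def)
    \<comment> \<open>\<open>f = a t\<^sup>A\<close>, and \<open>t\<close> is a unit\<close>
    have "Poly_Mapping.single (- A) 1 * f = Poly_Mapping.single 0 a"
    proof (rule poly_mapping_eqI)
      fix k
      show "Poly_Mapping.lookup (Poly_Mapping.single (- A) 1 * f) k = Poly_Mapping.lookup (Poly_Mapping.single 0 a) k"
        using keys[of "k + A"] by (auto simp: lookup_single_mult_int lookup_single when_def a_def)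
    qed
    then have "Poly_Mapping.single 0 a \<in> m" using maximal_laurentD(2)[OF m f(1), of "Poly_Mapping.single (- A) 1"] by simp
    then show False using no ab by blast
  qed
  then show ?thesis using maximal_contains_prime_of_int[OF m] that by blast
qed

text \<open>
  Each element of \<open>m\<close> is multiplied into \<open>(p) + (f)\<close> by a power of the leading coefficient of \<open>f\<close>,
  which is invertible modulo \<open>p\<close>.
\<close>

lemma maximal_laurent_prime_pair:
  assumes m: "maximalideal m int_laurent_ring"
  shows "\<exists>p s. laurent.prime_pair m p s"
proof -
  obtain p where p: "prime p" "Poly_Mapping.single 0 p \<in> m" using maximal_contains_prime[OF m] .
  obtain f where f: "f \<in> m" "supp_mod p f \<noteq> {}"
    and div: "\<And>g. g \<in> m \<Longrightarrow> \<exists>k q r. Poly_Mapping.single 0 (Poly_Mapping.lookup f (Max (supp_mod p f)) ^ k) * g =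
        q * f + Poly_Mapping.single 0 p * r"
    using maximal_min_width[OF m, of p] p by blast
  define a where "a = Poly_Mapping.lookup f (Max (supp_mod p f))"
  have a: "\<not> p dvd a" using Max_in[OF finite_supp_mod f(2)] by (simp add: a_def supp_mod_def)
  have "m = PIdl\<^bsub>int_laurent_ring\<^esub> (Poly_Mapping.single 0 p) <+>\<^bsub>int_laurent_ring\<^esub> PIdl\<^bsub>int_laurent_ring\<^esub> f"
  proof (intro equalityI subsetI)
    fix g assume "g \<in> m"
    then obtain k q r where kqr: "Poly_Mapping.single 0 (a ^ k) * g = q * f + Poly_Mapping.single 0 p * r"
      using div unfolding a_def by blast
    have "coprime (a ^ k) p"
      using prime_imp_coprime[OF p(1) a] by (simp add: coprime_commute)
    then obtain u v where uv: "u * a ^ k + v * p = 1"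
      using bezout_int[of "a ^ k" p] by auto
    have "Poly_Mapping.single 0 u * Poly_Mapping.single 0 (a ^ k) +
        Poly_Mapping.single 0 v * Poly_Mapping.single 0 p = (1 :: int \<Rightarrow>\<^sub>0 int)"
      by (simp add: mult_single single_add[symmetric] uv)
    then have "g = (Poly_Mapping.single 0 u * Poly_Mapping.single 0 (a ^ k) +
        Poly_Mapping.single 0 v * Poly_Mapping.single 0 p) * g" by simp
    also have "\<dots> = Poly_Mapping.single 0 u * (Poly_Mapping.single 0 (a ^ k) * g) +
        Poly_Mapping.single 0 v * Poly_Mapping.single 0 p * g"
      by (simp only: distrib_right mult.assoc)
    also have "\<dots> = (Poly_Mapping.single 0 u * r + Poly_Mapping.single 0 v * g) * Poly_Mapping.single 0 p +
        (Poly_Mapping.single 0 u * q) * f"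
      unfolding kqr by (simp add: algebra_simps)
    finally show "g \<in> PIdl\<^bsub>int_laurent_ring\<^esub> (Poly_Mapping.single 0 p) <+>\<^bsub>int_laurent_ring\<^esub>
        PIdl\<^bsub>int_laurent_ring\<^esub> f"
      unfolding laurent.PIdl_sum_iff by auto
  next
    fix g assume "g \<in> PIdl\<^bsub>int_laurent_ring\<^esub> (Poly_Mapping.single 0 p) <+>\<^bsub>int_laurent_ring\<^esub>
        PIdl\<^bsub>int_laurent_ring\<^esub> f"
    then show "g \<in> m" unfolding laurent.PIdl_sum_iff
      using p f maximal_laurentD(1,2)[OF m] by auto
  qed
  moreover have "f \<notin> PIdl\<^bsub>int_laurent_ring\<^esub> (Poly_Mapping.single 0 p)" using f by (simp add: PIdl_laurent)
  moreover have "Poly_Mapping.single 0 p \<noteq> (0 :: int \<Rightarrow>\<^sub>0 int)" 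
    using p(1) by (metis lookup_single_eq lookup_zero not_prime_0)
  ultimately show ?thesis
    using m p primeideal_laurent[of p] unfolding laurent.prime_pair_def by auto
qed

text \<open>
  A Laurent polynomial is determined by the graph of its coefficient function on the support, a
  finite set of pairs.
\<close>

lemma countable_laurent: "countable (UNIV :: (int \<Rightarrow>\<^sub>0 int) set)"
proof (rule countable_image_inj_on)
  define graph where "graph f = (\<lambda>k. (k, Poly_Mapping.lookup f k)) ` Poly_Mapping.keys f" for f :: "int \<Rightarrow>\<^sub>0 int"
  have "countable {A :: (int \<times> int) set. finite A}" by (rule countable_Collect_finite)
  then show "countable (range graph)" by (rule countable_subset[rotated]) (auto simp: graph_def)
  show "inj graph"
  proof (intro injI poly_mapping_eqI)
    fix f g k assume eq: "graph f = graph g"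
    have graph: "(k, c) \<in> graph h \<longleftrightarrow> c \<noteq> 0 \<and> Poly_Mapping.lookup h k = c" for h c
      by (auto simp: graph_def in_keys_iff)
    have "c \<noteq> 0 \<and> Poly_Mapping.lookup f k = c \<longleftrightarrow> c \<noteq> 0 \<and> Poly_Mapping.lookup g k = c" for c
      using graph[of c f] graph[of c g] eq by simp
    from this[of "Poly_Mapping.lookup f k"] this[of "Poly_Mapping.lookup g k"]
    show "Poly_Mapping.lookup f k = Poly_Mapping.lookup g k" by auto
  qed
qed

lemma countable_maximal_laurent: "countable {m. maximalideal m int_laurent_ring}"
proof (rule countable_subset)
  let ?I = "\<lambda>(p, s). PIdl\<^bsub>int_laurent_ring\<^esub> p <+>\<^bsub>int_laurent_ring\<^esub> PIdl\<^bsub>int_laurent_ring\<^esub> s"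
  show "{m. maximalideal m int_laurent_ring} \<subseteq> ?I ` (UNIV \<times> UNIV)"
    using maximal_laurent_prime_pair laurent.prime_pairD(9) by blast
  show "countable (?I ` (UNIV \<times> UNIV))"
    by (intro countable_image countable_SIGMA countable_laurent)
qed

text \<open>
  The evaluation at \<open>t = 1\<close>.
\<close>

definition augmentation :: "(int \<Rightarrow>\<^sub>0 int) \<Rightarrow> int" where
  "augmentation f = (\<Sum>k\<in>Poly_Mapping.keys f. Poly_Mapping.lookup f k)"

lemma augmentation_superset:
  assumes "finite A" "Poly_Mapping.keys f \<subseteq> A"
  shows "augmentation f = (\<Sum>k\<in>A. Poly_Mapping.lookup f k)"
  unfolding augmentation_def using assms by (intro sum.mono_neutral_left) (auto simp: in_keys_iff)

lemma augmentation_single: "augmentation (Poly_Mapping.single e c) = c"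
  by (simp add: augmentation_def)

lemma augmentation_add: "augmentation (f + g) = augmentation f + augmentation g"
proof -
  let ?A = "Poly_Mapping.keys f \<union> Poly_Mapping.keys g"
  show ?thesis
    using Poly_Mapping.keys_add[of f g]
    by (simp add: augmentation_superset[of ?A] lookup_add sum.distrib)
qed

lemma augmentation_mult: "augmentation (f * g) = augmentation f * augmentation g"
proof -
  let ?F = "Poly_Mapping.lookup f" and ?G = "Poly_Mapping.lookup g"
  define N where "N = (\<Union>k\<in>Poly_Mapping.keys f. (+) k ` Poly_Mapping.keys g)"
  have N: "finite N" by (simp add: N_def)
  have shift: "(\<Sum>n\<in>N. ?G (n - k)) = augmentation g" if k: "k \<in> Poly_Mapping.keys f" for k
  proof -
    have "(\<Sum>n\<in>(+) k ` Poly_Mapping.keys g. ?G (n - k)) = (\<Sum>n\<in>N. ?G (n - k))"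
    proof (rule sum.mono_neutral_left[OF N])
      show "(+) k ` Poly_Mapping.keys g \<subseteq> N" using k by (auto simp: N_def)
      show "\<forall>n\<in>N - (+) k ` Poly_Mapping.keys g. ?G (n - k) = 0"
      proof
        fix n assume "n \<in> N - (+) k ` Poly_Mapping.keys g"
        then have "n - k \<notin> Poly_Mapping.keys g" by (metis DiffD2 add_diff_cancel_left' diff_add_cancel image_eqI add.commute)
        then show "?G (n - k) = 0" by (simp add: in_keys_iff)
      qed
    qed
    then show ?thesis by (simp add: augmentation_def sum.reindex)
  qed
  have "Poly_Mapping.keys (f * g) \<subseteq> N" using Poly_Mapping.keys_mult[of f g] by (fastforce simp: N_def)
  then have "augmentation (f * g) = (\<Sum>n\<in>N. \<Sum>k\<in>Poly_Mapping.keys f. ?F k * ?G (n - k))"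
    by (simp add: augmentation_superset[OF N] lookup_mult_int)
  also have "\<dots> = (\<Sum>k\<in>Poly_Mapping.keys f. ?F k * (\<Sum>n\<in>N. ?G (n - k)))"
    by (subst sum.swap) (simp add: sum_distrib_left)
  also have "\<dots> = augmentation f * augmentation g"
    by (simp add: shift sum_distrib_right augmentation_def[of f])
  finally show ?thesis .
qed

text \<open>
  This is the kernel of the surjection \<open>R \<rightarrow> \<int>/q\<close> given by \<open>t \<mapsto> 1\<close>.
\<close>

lemma maximalideal_augmentation:
  assumes q: "prime q"
  shows "maximalideal {f. q dvd augmentation f} int_laurent_ring"
proof (rule maximalidealI)
  let ?m = "{f. q dvd augmentation f}"
  have one: "augmentation 1 = 1" using augmentation_single[of 0 1] by simp
  show "ideal ?m int_laurent_ring"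
    by (auto simp: ideal_laurent_iff augmentation_add augmentation_mult) (simp add: augmentation_def)
  have "1 \<notin> ?m" using prime_or_zero_not_dvd_one[of q] q by (simp add: one)
  then show "carrier int_laurent_ring \<noteq> ?m" by (metis UNIV_I int_laurent_ring_simps(1))
  fix J assume J: "ideal J int_laurent_ring" and sub: "?m \<subseteq> J"
  show "J = ?m \<or> J = carrier int_laurent_ring"
  proof (cases "J = ?m")
    case False
    then obtain f where f: "f \<in> J" "\<not> q dvd augmentation f" using sub by blast
    then have "coprime (augmentation f) q" 
      using prime_imp_coprime[OF q f(2)] by (simp add: coprime_commute)
    then obtain u v where uv: "u * augmentation f + v * q = 1"
      using bezout_int[of "augmentation f" q] by auto
    let ?u = "Poly_Mapping.single 0 u :: int \<Rightarrow>\<^sub>0 int"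
    have "augmentation (1 + - ?u * f) = v * q"
      using uv by (simp only: augmentation_add augmentation_mult one single_uminus[symmetric] augmentation_single)
    then have "1 + - ?u * f \<in> J" using sub by auto
    moreover have "?u * f \<in> J" using f J by (simp add: ideal_laurent_iff)
    ultimately have "1 + - ?u * f + ?u * f \<in> J" using J unfolding ideal_laurent_iff by blast
    then have "1 \<in> J" by simp
    then show ?thesis using ideal.one_imp_carrier[OF J] by simp
  qed simp
qed

lemma infinite_maximal_laurent: "infinite {m. maximalideal m int_laurent_ring}"
proof -
  let ?m = "\<lambda>q::nat. {f. int q dvd augmentation f}"
  have "inj_on ?m {q. prime q}"
  proof (rule inj_onI)
    fix q r :: nat assume q: "q \<in> {q. prime q}" and r: "r \<in> {q. prime q}" and eq: "?m q = ?m r"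
    have "Poly_Mapping.single 0 (int r) \<in> ?m s \<longleftrightarrow> s dvd r" for s
      using augmentation_single[of 0 "int r"] by simp
    from this[of q] this[of r] have "q dvd r" using eq by simp
    then show "q = r" using q r by (simp add: primes_dvd_imp_eq)
  qed
  then have "infinite (?m ` {q. prime q})"
    using primes_infinite finite_imageD by blast
  moreover have "?m ` {q. prime q} \<subseteq> {m. maximalideal m int_laurent_ring}"
    by (auto intro!: maximalideal_augmentation)
  ultimately show ?thesis by (rule infinite_super[rotated])
qed


theorem corollary3p4:
  shows "inj_on (ideal_class int_laurent_ring) {\<mm>. maximalideal \<mm> int_laurent_ring} \<and>
    (\<exists>N. free_submonoid_basis (ideal_class_monoid int_laurent_ring) N
           (ideal_class int_laurent_ring ` {\<mm>. maximalideal \<mm> int_laurent_ring}) \<and>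
         (ideal_class_monoid int_laurent_ring)\<lparr>carrier := N\<rparr> \<cong> nat_infinity)"
proof -
  note basis = laurent.maximal_ideal_classes_basis[OF maximal_laurent_prime_pair]
  have "countable (ideal_class int_laurent_ring ` {\<mm>. maximalideal \<mm> int_laurent_ring})"
    by (intro countable_image countable_maximal_laurent)
  moreover have "infinite (ideal_class int_laurent_ring ` {\<mm>. maximalideal \<mm> int_laurent_ring})"
    using infinite_maximal_laurent basis(1) finite_imageD by blast
  ultimately show ?thesis
    using basis free_submonoid_iso_nat_infinity by blast
qed

end
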